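(* Let $\alpha\in(0,2)$, let $Z$ be the standard isotropic $\alpha$-stable process in $\mathbb{C}$ with $Z_0=1$, let $\theta$ be its winding process around $0$, and let $\rho_u=\theta_{A(u)}$, $u\ge0$, be the time-changed winding process. Then for any non-decreasing function $f>0$, $$\limsup_{t\to0^+}\frac{\rho_t}{f(t)}=0\ \text{ a.s.}\iff\int_0^1 (f(t))^{-\alpha}\,dt<\infty,$$ and $$\limsup_{t\to0^+}\frac{\rho_t}{f(t)}=\infty\ \text{ a.s.}\iff\int_0^1 (f(t))^{-\alpha}\,dt=\infty .$$
   Context: $Z=(Z_t,t\ge0)$ is the standard isotropic stable process of index $\alpha\in(0,2)$ in $\mathbb{C}\cong\mathbb{R}^2$ starting from $1$: it has stationary independent increments, cadlag paths, and $E[\exp(i\langle\lambda,Z_t-Z_0\rangle)]=\exp(-t|\lambda|^\alpha)$ for all $t\ge0$, $\lambda\in\mathbb{C}$, with $\langle\cdot,\cdot\rangle$ the Euclidean inner product. Almost surely $Z$ never visits $0$, $|Z_t|\to\infty$, and no jump segment of $Z$ contains $0$. Winding process $\theta=(\theta_t,t\ge0)$: on $[0,t]$, complete the path of $Z$ into a continuous curve in $\mathbb{C}\setminus\{0\}$ starting at $1$ by filling in each jump with the line segment $[Z_{s-},Z_s]$; $\theta_t$ is the total variation of the continuous determination of the argument along this curve (signed total angle wound around $0$). Equivalently, $\theta$ is the cadlag process with $\theta_0=0$, $\exp(i\theta_t)=Z_t/|Z_t|$ for all $t$, and all jumps of absolute value less than $\pi$. Clock: $H(t)=\int_0^t |Z_s|^{-\alpha}\,ds$,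 with inverse $A(u)=\inf\{t\ge0: H(t)>u\}$. The process $\rho_u=\theta_{A(u)}$ is a symmetric real-valued L\'evy process started at $0$ (a known result). The function $f$ is defined on $(0,\infty)$. *)

theory Defs
  imports "HOL-Probability.Probability"
begin

text \<open>Paths and processes are indexed by \<^typ>\<open>real\<close>; only nonnegative times are ever inspected.\<close>

definition cadlag :: "(real \<Rightarrow> 'b::topological_space) \<Rightarrow> bool" where
  "cadlag x \<longleftrightarrow>
     (\<forall>t\<ge>0. (x \<longlongrightarrow> x t) (at_right t)) \<and>
     (\<forall>t>0. \<exists>l. (x \<longlongrightarrow> l) (at_left t))"

definition (in prob_space) independent_increments :: "(real \<Rightarrow> 'a \<Rightarrow> complex) \<Rightarrow> bool" where
  "independent_increments X \<longleftrightarrow>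
     (\<forall>(n::nat) (t::nat \<Rightarrow> real). 0 \<le> t 0 \<and> (\<forall>i<n. t i \<le> t (Suc i)) \<longrightarrow>
        indep_vars (\<lambda>_. borel) (\<lambda>i \<omega>. X (t (Suc i)) \<omega> - X (t i) \<omega>) {..<n})"

definition (in prob_space) stationary_increments :: "(real \<Rightarrow> 'a \<Rightarrow> complex) \<Rightarrow> bool" where
  "stationary_increments X \<longleftrightarrow>
     (\<forall>s\<ge>0. \<forall>t\<ge>0. distr M borel (\<lambda>\<omega>. X (s + t) \<omega> - X s \<omega>) = distr M borel (\<lambda>\<omega>. X t \<omega> - X 0 \<omega>))"

text \<open>
  Here \<open>\<bullet>\<close> is the Euclidean inner product on \<^typ>\<open>complex\<close>
  regarded as the real plane.
\<close>

definition (in prob_space) isotropic_stable_process ::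
    "real \<Rightarrow> complex \<Rightarrow> (real \<Rightarrow> 'a \<Rightarrow> complex) \<Rightarrow> bool" where
  "isotropic_stable_process \<alpha> z\<^sub>0 Z \<longleftrightarrow>
     (\<forall>t\<ge>0. random_variable borel (Z t)) \<and>
     (AE \<omega> in M. Z 0 \<omega> = z\<^sub>0) \<and>
     (AE \<omega> in M. cadlag (\<lambda>t. Z t \<omega>)) \<and>
     independent_increments Z \<and>
     stationary_increments Z \<and>
     (\<forall>t\<ge>0. \<forall>\<xi>. expectation (\<lambda>\<omega>. exp (\<i> * complex_of_real (\<xi> \<bullet> (Z t \<omega> - Z 0 \<omega>)))) =
               complex_of_real (exp (- (t * norm \<xi> powr \<alpha>))))"

text \<open>
  The winding path of a cadlag planar path \<open>z\<close> around the origin: the cadlag argument of \<open>z\<close>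
  started at \<open>0\<close>, with all jumps smaller than \<open>\<pi>\<close> in absolute value, i.e. across a jump the
  argument changes as along the segment from the left limit to the new value. Two such paths
  differ by a cadlag function with values in the integer multiples of \<open>2\<pi>\<close> and jumps smaller
  than \<open>2\<pi>\<close>, so there is at most one on the nonnegative half-line. The third clause forces
  \<open>z\<close> to avoid \<open>0\<close>, because \<open>0 / 0 = 0\<close> is not a value of \<^const>\<open>cis\<close>.
\<close>

definition is_winding_path :: "(real \<Rightarrow> complex) \<Rightarrow> (real \<Rightarrow> real) \<Rightarrow> bool" where
  "is_winding_path z \<theta> \<longleftrightarrow>
     cadlag \<theta> \<and>
     \<theta> 0 = 0 \<and>
     (\<forall>t\<ge>0. cis (\<theta> t) = z t / complex_of_real (norm (z t))) \<and>
     (\<forall>t>0. \<forall>l. (\<theta> \<longlongrightarrow> l) (at_left t) \<longrightarrow> \<bar>\<theta> t - l\<bar> < pi)"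

text \<open>
  The clock takes extended nonnegative values, so no integrability convention is hidden in it.
  For paths of the stable process it is almost surely finite with limit \<open>\<infinity>\<close>; then the
  infimum in \<open>inverse_clock\<close> is over a nonempty set.
\<close>

definition clock :: "real \<Rightarrow> (real \<Rightarrow> complex) \<Rightarrow> real \<Rightarrow> ennreal" where
  "clock \<alpha> z t = (\<integral>\<^sup>+ s \<in> {0..t}. ennreal (norm (z s) powr - \<alpha>) \<partial>lborel)"

definition inverse_clock :: "real \<Rightarrow> (real \<Rightarrow> complex) \<Rightarrow> real \<Rightarrow> real" where
  "inverse_clock \<alpha> z u = Inf {t. 0 \<le> t \<and> ennreal u < clock \<alpha> z t}"

definition time_changed_winding ::
    "real \<Rightarrow> (real \<Rightarrow> 'a \<Rightarrow> complex) \<Rightarrow> (real \<Rightarrow> 'a \<Rightarrow> real) \<Rightarrow> real \<Rightarrow> 'a \<Rightarrow> real" where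
  "time_changed_winding \<alpha> Z \<theta> u \<omega> = \<theta> (inverse_clock \<alpha> (\<lambda>t. Z t \<omega>) u) \<omega>"

end

theory Submission
  imports Defs
begin

text \<open>
Only the behaviour at time \<open>0\<close> matters, and there the winding process is a small
perturbation of the imaginary part \<open>Y\<^sub>t = Im (Z\<^sub>t - Z\<^sub>0)\<close>. As \<open>Z\<close> starts at \<open>1\<close> and is
right-continuous, the clock has speed between \<open>1/2\<close> and \<open>2\<close> near \<open>0\<close>, and \<open>sin \<theta>\<^sub>t = Im Z\<^sub>t
/ |Z\<^sub>t|\<close> makes \<open>\<theta>\<^sub>t\<close> comparable to \<open>Y\<^sub>t\<close>, with the same sign where \<open>Y\<^sub>t\<close> is nonnegative
(\<open>clock_near_start\<close>). Constant factors in space and in time are harmless for a monotone \<open>f\<close>,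
so the theorem is Khintchine's integral test for the one-dimensional symmetric stable
process \<open>Y\<close>, applied path by path.

The integral test is run along the times \<open>2\<^sup>-\<^sup>n\<close>: the integral of \<open>f\<^sup>-\<^sup>\<alpha>\<close> converges exactly
when the series of \<open>2\<^sup>-\<^sup>n f(2\<^sup>-\<^sup>n)\<^sup>-\<^sup>\<alpha>\<close> does, and up to constants the terms of this series,
cut off at \<open>1\<close>, are the probabilities \<open>P(|Y| > f)\<close> at time \<open>2\<^sup>-\<^sup>n\<close>, because the tail of
\<open>Y\<^sub>t\<close> at level \<open>x\<close> has order \<open>min 1 (t x\<^sup>-\<^sup>\<alpha>)\<close> (\<open>symmetric_stable_tail_le\<close>,
\<open>symmetric_stable_tail_ge\<close>).

If the series converges, Ottaviani's inequality extends the upper tail bound to the running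
maximum, and the first Borel--Cantelli lemma shows that \<open>Y\<close> is eventually below every
multiple of \<open>f\<close> (\<open>small_near_zero\<close>).

If it diverges, the second Borel--Cantelli lemma makes infinitely many of the independent
increments over \<open>[2\<^sup>-\<^sup>n\<^sup>-\<^sup>2, 2\<^sup>-\<^sup>n\<^sup>-\<^sup>1]\<close> exceed a given multiple of \<open>f\<close>. Then \<open>Y\<close> or \<open>- Y\<close>
exceeds half that multiple infinitely often. Which of the two happens is a tail event for
the increments, so Kolmogorov's zero--one law and the symmetry of the increments give both
almost surely (\<open>large_near_zero\<close>).
\<close>

section \<open>Tails of one-dimensional symmetric stable laws\<close>

text \<open>
The law of the increment over a time interval of length \<open>t\<close>. Keeping \<open>t\<close> as a parameter,
instead of rescaling to \<open>t = 1\<close>, lets the bounds below be used at every time without appeal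
to self-similarity.
\<close>

definition (in prob_space) symmetric_stable :: "real \<Rightarrow> real \<Rightarrow> ('a \<Rightarrow> real) \<Rightarrow> bool" where
  "symmetric_stable \<alpha> t X \<longleftrightarrow>
     random_variable borel X \<and>
     (\<forall>u. char (distr M borel X) u = complex_of_real (exp (- (t * \<bar>u\<bar> powr \<alpha>))))"

lemma (in prob_space) symmetric_stable_measurable:
  "symmetric_stable \<alpha> t X \<Longrightarrow> random_variable borel X"
  by (simp add: symmetric_stable_def)

lemma (in prob_space) symmetric_stable_expectation_cos:
  assumes "symmetric_stable \<alpha> t X"
  shows "expectation (\<lambda>\<omega>. cos (u * X \<omega>)) = exp (- (t * \<bar>u\<bar> powr \<alpha>))"
proof -
  have [measurable]: "random_variable borel X"
    using assms by (rule symmetric_stable_measurable)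
  have int: "integrable M (\<lambda>\<omega>. iexp (u * X \<omega>))"
    by (intro integrable_const_bound[where B=1]) auto
  have "complex_of_real (exp (- (t * \<bar>u\<bar> powr \<alpha>))) = expectation (\<lambda>\<omega>. iexp (u * X \<omega>))"
    using assms by (simp add: symmetric_stable_def char_def integral_distr)
  then have "exp (- (t * \<bar>u\<bar> powr \<alpha>)) = Re (expectation (\<lambda>\<omega>. iexp (u * X \<omega>)))"
    by (metis Re_complex_of_real)
  also have "\<dots> = expectation (\<lambda>\<omega>. Re (iexp (u * X \<omega>)))"
    by (rule integral_Re[symmetric, OF int])
  finally show ?thesis by (simp add: Re_exp)
qed

lemma (in prob_space) symmetric_stable_uminus:
  assumes "symmetric_stable \<alpha> t X"
  shows "symmetric_stable \<alpha> t (\<lambda>\<omega>. - X \<omega>)"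
proof -
  have [measurable]: "random_variable borel X"
    using assms by (rule symmetric_stable_measurable)
  have "char (distr M borel (\<lambda>\<omega>. - X \<omega>)) u = char (distr M borel X) (- u)" for u
    by (simp add: char_def integral_distr)
  then show ?thesis using assms by (simp add: symmetric_stable_def)
qed

lemma (in prob_space) symmetric_stable_distr_uminus:
  assumes "symmetric_stable \<alpha> t X"
  shows "distr M borel (\<lambda>\<omega>. - X \<omega>) = distr M borel X"
proof (rule Levy_uniqueness)
  have X[measurable]: "random_variable borel X"
    using assms by (rule symmetric_stable_measurable)
  show "real_distribution (distr M borel X)" "real_distribution (distr M borel (\<lambda>\<omega>. - X \<omega>))"
    by (simp_all add: real_distribution_distr)
  show "char (distr M borel (\<lambda>\<omega>. - X \<omega>)) = char (distr M borel X)"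
    using assms symmetric_stable_uminus[OF assms] by (auto simp: symmetric_stable_def)
qed

lemma std_normal_expectation_cos:
  "(LINT n|std_normal_distribution. cos (y * n)) = exp (- y\<^sup>2 / 2)"
proof -
  interpret N: real_distribution std_normal_distribution by (rule real_dist_normal_dist)
  have int: "integrable std_normal_distribution (\<lambda>n. iexp (y * n))"
    by (intro N.integrable_const_bound[where B=1]) auto
  have "exp (- y\<^sup>2 / 2) = Re (LINT n|std_normal_distribution. iexp (y * n))"
    using fun_cong[OF char_std_normal_distribution, of y] unfolding char_def
    by (metis Re_complex_of_real)
  also have "\<dots> = (LINT n|std_normal_distribution. Re (iexp (y * n)))"
    by (rule integral_Re[symmetric, OF int])
  finally show ?thesis by (simp add: Re_exp)
qed

text \<open>
Averaging the characteristic function over a Gaussian frequency: \<open>exp (- y\<^sup>2 / 2)\<close> is the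
expectation of \<open>cos (y N)\<close> for a standard normal \<open>N\<close>, so by Fubini the left-hand side is the
mean of \<open>1 - exp (- t |N / \<delta>|\<^sup>\<alpha>)\<close>, and \<open>|N|\<^sup>\<alpha> \<le> 1 + N\<^sup>2\<close> has mean at most \<open>2\<close>. This replaces
any knowledge of the stable density.
\<close>

lemma (in prob_space) symmetric_stable_gaussian_average:
  assumes X: "symmetric_stable \<alpha> t X" and "0 \<le> t" "0 < \<delta>" "0 < \<alpha>" "\<alpha> < 2"
  shows "1 - expectation (\<lambda>\<omega>. exp (- (X \<omega> / \<delta>)\<^sup>2 / 2)) \<le> 2 * (t * \<delta> powr - \<alpha>)"
proof -
  have [measurable]: "random_variable borel X"
    using X by (rule symmetric_stable_measurable)
  interpret N: real_distribution std_normal_distribution by (rule real_dist_normal_dist)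
  let ?N = "std_normal_distribution"
  interpret P: pair_prob_space M ?N ..
  have "expectation (\<lambda>\<omega>. exp (- (X \<omega> / \<delta>)\<^sup>2 / 2)) = (\<integral>\<omega>. \<integral>n. cos (X \<omega> / \<delta> * n) \<partial>?N \<partial>M)"
    by (simp only: std_normal_expectation_cos)
  also have "\<dots> = (\<integral>n. \<integral>\<omega>. cos (X \<omega> / \<delta> * n) \<partial>M \<partial>?N)"
    by (rule P.Fubini_integral[symmetric])
       (auto intro!: P.integrable_const_bound[where B=1] simp: split_beta')
  also have "\<dots> = (\<integral>n. exp (- (t * \<bar>n / \<delta>\<bar> powr \<alpha>)) \<partial>?N)"
  proof (rule Bochner_Integration.integral_cong[OF refl])
    fix n :: real
    have "(\<integral>\<omega>. cos (X \<omega> / \<delta> * n) \<partial>M) = expectation (\<lambda>\<omega>. cos (n / \<delta> * X \<omega>))"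
      by (simp add: ac_simps)
    then show "(\<integral>\<omega>. cos (X \<omega> / \<delta> * n) \<partial>M) = exp (- (t * \<bar>n / \<delta>\<bar> powr \<alpha>))"
      using symmetric_stable_expectation_cos[OF X, of "n / \<delta>"] by simp
  qed
  finally have eq: "expectation (\<lambda>\<omega>. exp (- (X \<omega> / \<delta>)\<^sup>2 / 2)) = (\<integral>n. exp (- (t * \<bar>n / \<delta>\<bar> powr \<alpha>)) \<partial>?N)" .
  have sq: "integrable ?N (\<lambda>n. n\<^sup>2)" "(\<integral>n. n\<^sup>2 \<partial>?N) = 1"
    using std_normal_distribution_even_moments[of 1] by (simp_all add: fact_numeral)
  have int: "integrable ?N (\<lambda>n. exp (- (t * \<bar>n / \<delta>\<bar> powr \<alpha>)))"
    using \<open>0 \<le> t\<close> by (intro N.integrable_const_bound[where B=1]) auto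
  have pt: "1 - exp (- (t * \<bar>n / \<delta>\<bar> powr \<alpha>)) \<le> t * \<delta> powr - \<alpha> * (1 + n\<^sup>2)" for n :: real
  proof -
    have "\<bar>n\<bar> powr \<alpha> \<le> 1 + n\<^sup>2"
    proof (cases "\<bar>n\<bar> \<le> 1")
      case True
      then have "\<bar>n\<bar> powr \<alpha> \<le> 1" using \<open>0 < \<alpha>\<close> by (intro powr_le1) auto
      then show ?thesis by (simp add: add_increasing2)
    next
      case False
      then have "\<bar>n\<bar> powr \<alpha> \<le> \<bar>n\<bar> powr 2" using \<open>\<alpha> < 2\<close> by (intro powr_mono) auto
      also have "\<dots> = n\<^sup>2" using False by (simp add: powr_numeral)
      finally show ?thesis by simp
    qed
    then have "t * \<delta> powr - \<alpha> * \<bar>n\<bar> powr \<alpha> \<le> t * \<delta> powr - \<alpha> * (1 + n\<^sup>2)"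
      using \<open>0 \<le> t\<close> by (intro mult_left_mono) auto
    moreover have "\<bar>n / \<delta>\<bar> powr \<alpha> = \<delta> powr - \<alpha> * \<bar>n\<bar> powr \<alpha>"
      using \<open>0 < \<delta>\<close> by (simp add: powr_divide powr_minus field_simps)
    moreover have "1 - exp (- (t * \<bar>n / \<delta>\<bar> powr \<alpha>)) \<le> t * \<bar>n / \<delta>\<bar> powr \<alpha>"
      using exp_ge_add_one_self[of "- (t * \<bar>n / \<delta>\<bar> powr \<alpha>)"] by simp
    ultimately show ?thesis by (simp add: ac_simps)
  qed
  have "1 - (\<integral>n. exp (- (t * \<bar>n / \<delta>\<bar> powr \<alpha>)) \<partial>?N)
      = (\<integral>n. 1 - exp (- (t * \<bar>n / \<delta>\<bar> powr \<alpha>)) \<partial>?N)"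
    using N.prob_space int by simp
  also have "\<dots> \<le> (\<integral>n. t * \<delta> powr - \<alpha> * (1 + n\<^sup>2) \<partial>?N)"
    by (rule integral_mono[OF _ _ pt]) (use int sq in auto)
  also have "\<dots> = 2 * (t * \<delta> powr - \<alpha>)"
    using sq N.prob_space by simp
  finally show ?thesis by (simp only: eq)
qed

lemma half_le_one_minus_exp:
  fixes s :: real
  assumes "0 \<le> s" "s \<le> 1"
  shows "s / 2 \<le> 1 - exp (- s)"
proof -
  have "exp (- s) \<le> 1 / (1 + s)"
    using exp_ge_add_one_self[of s] assms by (simp add: exp_minus field_simps)
  also have "\<dots> \<le> 1 - s / 2"
    using assms mult_left_le[of s s] by (simp add: field_simps)
  finally show ?thesis by simp
qed

lemma min_square_one_le_gaussian: "min (y\<^sup>2) 1 \<le> 4 * (1 - exp (- y\<^sup>2 / 2))" for y :: real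
proof (cases "\<bar>y\<bar> \<le> 1")
  case True
  then have "y\<^sup>2 \<le> 1" by (simp add: abs_square_le_1)
  then show ?thesis using half_le_one_minus_exp[of "y\<^sup>2 / 2"] by (simp add: min_def)
next
  case False
  then have y: "1 \<le> y\<^sup>2" using one_le_power[of "\<bar>y\<bar>" 2] by simp
  then have "exp (- y\<^sup>2 / 2) \<le> exp (- (1/2))" by simp
  moreover have "1 / 4 \<le> 1 - exp (- (1/2) :: real)"
    using half_le_one_minus_exp[of "1/2"] by simp
  moreover have "1 \<le> 4 * (1 - e)" if "e \<le> c" "1 / 4 \<le> 1 - c" for c e :: real
    using that by simp
  ultimately show ?thesis unfolding min_absorb2[OF y] by blast
qed

text \<open>
This one estimate controls both tails: it gives the upper bound by Markov's inequality, and
in the lower bound it shows that the small values of \<open>X\<close> contribute little to \<open>1 - cos (u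
X)\<close>.
\<close>

lemma (in prob_space) symmetric_stable_truncated_square:
  assumes X: "symmetric_stable \<alpha> t X" and "0 \<le> t" "0 < \<delta>" "0 < \<alpha>" "\<alpha> < 2"
  shows "expectation (\<lambda>\<omega>. min ((X \<omega> / \<delta>)\<^sup>2) 1) \<le> 8 * (t * \<delta> powr - \<alpha>)"
proof -
  have [measurable]: "random_variable borel X"
    using X by (rule symmetric_stable_measurable)
  have int: "integrable M (\<lambda>\<omega>. exp (- (X \<omega> / \<delta>)\<^sup>2 / 2))"
    by (intro integrable_const_bound[where B=1]) auto
  have "expectation (\<lambda>\<omega>. min ((X \<omega> / \<delta>)\<^sup>2) 1) \<le> expectation (\<lambda>\<omega>. 4 * (1 - exp (- (X \<omega> / \<delta>)\<^sup>2 / 2)))"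
    by (rule integral_mono[OF _ _ min_square_one_le_gaussian])
       (use int in \<open>auto intro!: integrable_const_bound[where B=1]\<close>)
  also have "\<dots> = 4 * (1 - expectation (\<lambda>\<omega>. exp (- (X \<omega> / \<delta>)\<^sup>2 / 2)))"
    using int by (simp add: prob_space)
  also have "\<dots> \<le> 8 * (t * \<delta> powr - \<alpha>)"
    using symmetric_stable_gaussian_average[OF assms] by simp
  finally show ?thesis .
qed

lemma (in prob_space) symmetric_stable_tail_le:
  assumes X: "symmetric_stable \<alpha> t X" and "0 \<le> t" "0 < \<delta>" "0 < \<alpha>" "\<alpha> < 2"
  shows "prob {\<omega> \<in> space M. \<delta> < \<bar>X \<omega>\<bar>} \<le> 8 * (t * \<delta> powr - \<alpha>)"
proof -
  have [measurable]: "random_variable borel X"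
    using X by (rule symmetric_stable_measurable)
  have "prob {\<omega> \<in> space M. \<delta> < \<bar>X \<omega>\<bar>} = expectation (indicator {\<omega> \<in> space M. \<delta> < \<bar>X \<omega>\<bar>})"
    by simp
  also have "\<dots> \<le> expectation (\<lambda>\<omega>. min ((X \<omega> / \<delta>)\<^sup>2) 1)"
  proof (rule integral_mono)
    show "integrable M (\<lambda>\<omega>. min ((X \<omega> / \<delta>)\<^sup>2) 1)"
      by (intro integrable_const_bound[where B=1]) auto
    fix \<omega>
    have "1 \<le> (X \<omega> / \<delta>)\<^sup>2" if "\<delta> < \<bar>X \<omega>\<bar>"
      using that \<open>0 < \<delta>\<close> by (simp add: power_divide abs_le_square_iff[symmetric])
    then show "indicator {\<omega> \<in> space M. \<delta> < \<bar>X \<omega>\<bar>} \<omega> \<le> min ((X \<omega> / \<delta>)\<^sup>2) 1"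
      by (auto simp: indicator_def)
  qed (auto intro!: integrable_const_bound[where B=1])
  also have "\<dots> \<le> 8 * (t * \<delta> powr - \<alpha>)"
    by (rule symmetric_stable_truncated_square[OF assms])
  finally show ?thesis .
qed

text \<open>
Compare two estimates of the mean of \<open>1 - cos (u X)\<close> at \<open>u = \<eta> / \<delta>\<close>. With \<open>s = t \<delta>\<^sup>-\<^sup>\<alpha> \<le> 1\<close>
it equals \<open>1 - exp (- s \<eta>\<^sup>\<alpha>) \<ge> s \<eta>\<^sup>\<alpha> / 2\<close>. The part of the mean from \<open>|X| \<le> \<delta>\<close> is at most \<open>4
\<eta>\<^sup>2 s\<close>, and the rest is at most twice the tail probability. As \<open>\<alpha> < 2\<close>, the term \<open>4 \<eta>\<^sup>2 s\<close>
is dominated by \<open>s \<eta>\<^sup>\<alpha> / 2\<close> for small \<open>\<eta>\<close>; the chosen \<open>\<eta>\<close>, with \<open>\<eta>\<^sup>2 = \<eta>\<^sup>\<alpha> / 16\<close>, makes it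
half as large. For \<open>s > 1\<close> the tail is bounded below by the tail at the larger level
\<open>t\<^sup>1\<^sup>/\<^sup>\<alpha>\<close>, where \<open>s\<close> becomes \<open>1\<close>.
\<close>

lemma (in prob_space) symmetric_stable_tail_ge:
  fixes \<alpha> :: real
  defines "\<eta> \<equiv> (1/16) powr (1 / (2 - \<alpha>)) :: real"
  assumes X: "symmetric_stable \<alpha> t X" and "0 < t" "0 < \<delta>" "0 < \<alpha>" "\<alpha> < 2"
  shows "\<eta> powr \<alpha> / 8 * min 1 (t * \<delta> powr - \<alpha>) \<le> prob {\<omega> \<in> space M. \<delta> < \<bar>X \<omega>\<bar>}"
proof -
  have [measurable]: "random_variable borel X"
    using X by (rule symmetric_stable_measurable)
  have \<eta>: "0 < \<eta>" "\<eta> \<le> 1"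
    using \<open>\<alpha> < 2\<close> by (auto simp: \<eta>_def intro!: powr_le1)
  have \<eta>\<alpha>: "\<eta> powr \<alpha> \<le> 1" using \<eta> \<open>0 < \<alpha>\<close> by (intro powr_le1) auto
  have "\<eta> powr (2 - \<alpha>) = 1 / 16"
    using \<open>\<alpha> < 2\<close> by (simp add: \<eta>_def powr_powr)
  moreover have "\<eta> powr (2 - \<alpha>) * \<eta> powr \<alpha> = \<eta>\<^sup>2"
    using \<eta> by (simp add: powr_add[symmetric] powr_numeral)
  ultimately have \<eta>2: "\<eta>\<^sup>2 = \<eta> powr \<alpha> / 16"
    by (metis mult.commute times_divide_eq_right mult.right_neutral)
  have main: "\<eta> powr \<alpha> / 8 * (t * d powr - \<alpha>) \<le> prob {\<omega> \<in> space M. d < \<bar>X \<omega>\<bar>}"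
    if d: "0 < d" and small: "t * d powr - \<alpha> \<le> 1" for d
  proof -
    define s where "s = t * d powr - \<alpha>"
    define u where "u = \<eta> / d"
    let ?p = "prob {\<omega> \<in> space M. d < \<bar>X \<omega>\<bar>}"
    have s: "0 \<le> s" "s \<le> 1" using \<open>0 < t\<close> small by (simp_all add: s_def)
    have u: "0 < u" "u * d = \<eta>" using d \<eta> by (simp_all add: u_def)
    have sq: "integrable M (\<lambda>\<omega>. min ((X \<omega> / d)\<^sup>2) 1)"
      by (intro integrable_const_bound[where B=1]) auto
    have ind: "integrable M (\<lambda>\<omega>. indicator {\<omega> \<in> space M. d < \<bar>X \<omega>\<bar>} \<omega> :: real)"
      by (intro integrable_const_bound[where B=1]) auto
    have cos: "integrable M (\<lambda>\<omega>. cos (u * X \<omega>))"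
      by (intro integrable_const_bound[where B=1]) auto
    have pt: "1 - cos (u * X \<omega>) \<le> \<eta>\<^sup>2 / 2 * min ((X \<omega> / d)\<^sup>2) 1
        + 2 * indicator {\<omega> \<in> space M. d < \<bar>X \<omega>\<bar>} \<omega>" if "\<omega> \<in> space M" for \<omega>
    proof (cases "d < \<bar>X \<omega>\<bar>")
      case True
      then have "1 - cos (u * X \<omega>) \<le> 2 * indicator {\<omega> \<in> space M. d < \<bar>X \<omega>\<bar>} \<omega>"
        using that cos_ge_minus_one[of "u * X \<omega>"] by (simp del: cos_ge_minus_one)
      moreover have "0 \<le> \<eta>\<^sup>2 / 2 * min ((X \<omega> / d)\<^sup>2) 1" by simp
      ultimately show ?thesis by linarith
    next
      case False
      then have "\<bar>X \<omega> / d\<bar> \<le> 1" using d by simp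
      then have "(X \<omega> / d)\<^sup>2 \<le> 1" by (simp only: abs_square_le_1)
      moreover have "1 - cos (u * X \<omega>) \<le> (u * X \<omega>)\<^sup>2 / 2"
      proof -
        have "(sin (u * X \<omega> / 2))\<^sup>2 \<le> (u * X \<omega> / 2)\<^sup>2"
          by (rule abs_le_square_iff[THEN iffD1, OF abs_sin_x_le_abs_x])
        then show ?thesis
          using cos_double_sin[of "u * X \<omega> / 2"] by (simp add: power_divide)
      qed
      moreover have "(u * X \<omega>)\<^sup>2 = \<eta>\<^sup>2 * (X \<omega> / d)\<^sup>2"
        by (simp add: u_def power_mult_distrib power_divide)
      ultimately show ?thesis using False by (simp add: min_absorb1 del: power_divide)
    qed
    have "u powr \<alpha> = \<eta> powr \<alpha> * d powr - \<alpha>"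
      using d \<eta> by (simp add: u_def powr_divide powr_minus field_simps)
    then have "1 - exp (- (s * \<eta> powr \<alpha>)) = 1 - expectation (\<lambda>\<omega>. cos (u * X \<omega>))"
      using u(1) by (simp add: symmetric_stable_expectation_cos[OF X] s_def ac_simps)
    also have "\<dots> = expectation (\<lambda>\<omega>. 1 - cos (u * X \<omega>))"
      using cos by (simp add: prob_space)
    also have "\<dots> \<le> expectation (\<lambda>\<omega>. \<eta>\<^sup>2 / 2 * min ((X \<omega> / d)\<^sup>2) 1
        + 2 * indicator {\<omega> \<in> space M. d < \<bar>X \<omega>\<bar>} \<omega>)"
      by (rule integral_mono[OF _ _ pt]) (use cos sq ind in auto)
    also have "\<dots> = \<eta>\<^sup>2 / 2 * expectation (\<lambda>\<omega>. min ((X \<omega> / d)\<^sup>2) 1) + 2 * ?p"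
      using sq ind by simp
    also have "\<dots> \<le> \<eta>\<^sup>2 / 2 * (8 * s) + 2 * ?p"
      using symmetric_stable_truncated_square[OF X _ d \<open>0 < \<alpha>\<close> \<open>\<alpha> < 2\<close>] \<open>0 < t\<close>
      unfolding s_def by (intro add_right_mono mult_left_mono) auto
    finally have "1 - exp (- (s * \<eta> powr \<alpha>)) \<le> \<eta> powr \<alpha> * s / 4 + 2 * ?p"
      by (simp add: \<eta>2 mult.commute)
    moreover have "s * \<eta> powr \<alpha> / 2 \<le> 1 - exp (- (s * \<eta> powr \<alpha>))"
      using s \<eta>\<alpha> by (intro half_le_one_minus_exp) (auto intro: mult_le_one)
    ultimately show ?thesis unfolding s_def[symmetric] by (simp add: field_simps)
  qed
  show ?thesis
  proof (cases "t * \<delta> powr - \<alpha> \<le> 1")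
    case True
    then show ?thesis using main[OF \<open>0 < \<delta>\<close>] by simp
  next
    case False
    define d where "d = t powr (1 / \<alpha>)"
    have d: "0 < d" using \<open>0 < t\<close> by (simp add: d_def)
    have td: "t * d powr - \<alpha> = 1"
      using \<open>0 < t\<close> \<open>0 < \<alpha>\<close> by (simp add: d_def powr_powr powr_minus)
    have "\<delta> powr \<alpha> < t"
      using False \<open>0 < \<delta>\<close> by (simp add: powr_minus field_simps)
    then have "(\<delta> powr \<alpha>) powr (1 / \<alpha>) \<le> d"
      unfolding d_def using \<open>0 < \<alpha>\<close> by (intro powr_mono2) auto
    then have "\<delta> \<le> d"
      using \<open>0 < \<delta>\<close> \<open>0 < \<alpha>\<close> by (simp add: powr_powr)
    then have "prob {\<omega> \<in> space M. d < \<bar>X \<omega>\<bar>} \<le> prob {\<omega> \<in> space M. \<delta> < \<bar>X \<omega>\<bar>}"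
      by (intro finite_measure_mono) auto
    then show ?thesis using main[OF d] td False by simp
  qed
qed

lemma (in prob_space) symmetric_stable_tail_half:
  assumes X: "symmetric_stable \<alpha> t X" and "0 < \<delta>"
  shows "prob {\<omega> \<in> space M. \<delta> < \<bar>X \<omega>\<bar>} = 2 * prob {\<omega> \<in> space M. \<delta> < X \<omega>}"
proof -
  have [measurable]: "random_variable borel X"
    using X by (rule symmetric_stable_measurable)
  have "prob {\<omega> \<in> space M. \<delta> < - X \<omega>} = measure (distr M borel (\<lambda>\<omega>. - X \<omega>)) {\<delta><..}"
    by (subst measure_distr) (auto intro!: arg_cong[where f=prob])
  also have "\<dots> = measure (distr M borel X) {\<delta><..}"
    by (simp add: symmetric_stable_distr_uminus[OF X])
  also have "\<dots> = prob {\<omega> \<in> space M. \<delta> < X \<omega>}"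
    by (subst measure_distr) (auto intro!: arg_cong[where f=prob])
  finally have eq: "prob {\<omega> \<in> space M. \<delta> < - X \<omega>} = prob {\<omega> \<in> space M. \<delta> < X \<omega>}" .
  have "{\<omega> \<in> space M. \<delta> < \<bar>X \<omega>\<bar>} = {\<omega> \<in> space M. \<delta> < X \<omega>} \<union> {\<omega> \<in> space M. \<delta> < - X \<omega>}"
    by auto
  also have "prob \<dots> = prob {\<omega> \<in> space M. \<delta> < X \<omega>} + prob {\<omega> \<in> space M. \<delta> < - X \<omega>}"
    using \<open>0 < \<delta>\<close> by (intro finite_measure_Union) auto
  finally show ?thesis by (simp add: eq)
qed

section \<open>The maximal inequality for a stable process\<close>

text \<open>
Stop at the first partial sum beyond \<open>2 x\<close>. The remaining sum is independent of this event
and at most \<open>x\<close> in absolute value with probability at least \<open>1/2\<close>, and then the total is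
still beyond \<open>x\<close>.
\<close>

theorem (in prob_space) ottaviani:
  fixes X :: "nat \<Rightarrow> 'a \<Rightarrow> real"
  assumes ind: "indep_vars (\<lambda>_. borel) X {..<n}"
    and half: "\<And>k. k \<le> n \<Longrightarrow> prob {\<omega> \<in> space M. x < \<bar>\<Sum>i\<in>{k..<n}. X i \<omega>\<bar>} \<le> 1 / 2"
  shows "prob {\<omega> \<in> space M. \<exists>k\<le>n. 2 * x < \<bar>\<Sum>i<k. X i \<omega>\<bar>}
    \<le> 2 * prob {\<omega> \<in> space M. x < \<bar>\<Sum>i<n. X i \<omega>\<bar>}"
proof -
  have rv[measurable]: "i < n \<Longrightarrow> random_variable borel (X i)" for i
    using ind by (auto simp: indep_vars_def)
  let ?S = "\<lambda>k \<omega>. \<Sum>i<k. X i \<omega>"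
  have S[measurable]: "k \<le> n \<Longrightarrow> random_variable borel (?S k)" for k
    by (intro borel_measurable_sum) auto
  have R[measurable]: "random_variable borel (\<lambda>\<omega>. \<Sum>i\<in>{k..<n}. X i \<omega>)" for k
    by (intro borel_measurable_sum) auto
  define T where "T k = {\<omega> \<in> space M. 2 * x < \<bar>?S k \<omega>\<bar> \<and> (\<forall>j\<in>{..<k}. \<bar>?S j \<omega>\<bar> \<le> 2 * x)}" for k
  define D where "D k = {\<omega> \<in> space M. \<bar>\<Sum>i\<in>{k..<n}. X i \<omega>\<bar> \<le> x}" for k
  have T_ev: "T k \<in> events" if "k \<le> n" for k
    unfolding T_def using that by (intro sets.sets_Collect_conj sets.sets_Collect_finite_All) auto
  have D_ev: "D k \<in> events" for k unfolding D_def by measurable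
  have indep: "prob (T k \<inter> D k) = prob (T k) * prob (D k)" if "k \<le> n" for k
  proof -
    let ?A = "{..<k}" and ?B = "{k..<n}"
    have iv: "indep_var (PiM ?A (\<lambda>_. borel)) (\<lambda>\<omega>. restrict (\<lambda>i. X i \<omega>) ?A)
                        (PiM ?B (\<lambda>_. borel)) (\<lambda>\<omega>. restrict (\<lambda>i. X i \<omega>) ?B)"
      using that by (intro indep_var_restrict[OF ind]) auto
    define U where "U = {v \<in> space (PiM ?A (\<lambda>_. borel)). 2 * x < \<bar>\<Sum>i<k. v i\<bar> \<and> (\<forall>j\<in>{..<k}. \<bar>\<Sum>i<j. v i :: real\<bar> \<le> 2 * x)}"
    define V where "V = {v \<in> space (PiM ?B (\<lambda>_. borel)). \<bar>\<Sum>i\<in>?B. v i :: real\<bar> \<le> x}"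
    have sm: "(\<lambda>v. \<Sum>i<j. v i :: real) \<in> borel_measurable (PiM ?A (\<lambda>_. borel))" if "j \<le> k" for j
      using that by (intro borel_measurable_sum measurable_component_singleton) auto
    have U: "U \<in> sets (PiM ?A (\<lambda>_. borel))"
      unfolding U_def using sm by (intro sets.sets_Collect_conj sets.sets_Collect_finite_All) auto
    have V: "V \<in> sets (PiM ?B (\<lambda>_. borel))"
      unfolding V_def by measurable
    have eqT: "(\<lambda>\<omega>. restrict (\<lambda>i. X i \<omega>) ?A) -` U \<inter> space M = T k"
      by (auto simp: U_def T_def space_PiM)
    have eqD: "(\<lambda>\<omega>. restrict (\<lambda>i. X i \<omega>) ?B) -` V \<inter> space M = D k"
      by (auto simp: V_def D_def space_PiM)
    have "prob ((\<lambda>\<omega>. (restrict (\<lambda>i. X i \<omega>) ?A, restrict (\<lambda>i. X i \<omega>) ?B)) -` (U \<times> V) \<inter> space M)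
      = prob (T k) * prob (D k)"
      using indep_varD[OF iv U V] by (simp only: eqT eqD)
    also have "(\<lambda>\<omega>. (restrict (\<lambda>i. X i \<omega>) ?A, restrict (\<lambda>i. X i \<omega>) ?B)) -` (U \<times> V) \<inter> space M = T k \<inter> D k"
      using eqT eqD by blast
    finally show ?thesis .
  qed
  have Dhalf: "1 / 2 \<le> prob (D k)" if "k \<le> n" for k
  proof -
    have "D k = space M - {\<omega> \<in> space M. x < \<bar>\<Sum>i\<in>{k..<n}. X i \<omega>\<bar>}" by (auto simp: D_def)
    then have "prob (D k) = 1 - prob {\<omega> \<in> space M. x < \<bar>\<Sum>i\<in>{k..<n}. X i \<omega>\<bar>}"
      by (simp add: prob_compl)
    then show ?thesis using half[OF that] by simp
  qed
  have disj: "disjoint_family_on T {..n}"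
    unfolding disjoint_family_on_def
  proof (intro ballI impI)
    have less: "T a \<inter> T b = {}" if "a < b" for a b
      using that by (force simp: T_def not_le[symmetric])
    fix a b :: nat assume "a \<noteq> b"
    then show "T a \<inter> T b = {}"
      using less[of a b] less[of b a] by (cases "a < b") auto
  qed
  have cover: "{\<omega> \<in> space M. \<exists>k\<le>n. 2 * x < \<bar>?S k \<omega>\<bar>} = (\<Union>k\<in>{..n}. T k)"
  proof safe
    fix \<omega> k assume "\<omega> \<in> space M" "k \<le> n" "2 * x < \<bar>?S k \<omega>\<bar>"
    then show "\<omega> \<in> (\<Union>k\<in>{..n}. T k)"
    proof (induction k rule: less_induct)
      case (less k)
      show ?case
      proof (cases "\<exists>j<k. 2 * x < \<bar>?S j \<omega>\<bar>")
        case True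
        then show ?thesis using less.IH less.prems by (meson less_imp_le less_le_trans)
      next
        case False
        then have "\<omega> \<in> T k" using less.prems by (fastforce simp: T_def)
        then show ?thesis using \<open>k \<le> n\<close> by blast
      qed
    qed
  qed (auto simp: T_def)
  have sub: "(\<Union>k\<in>{..n}. T k \<inter> D k) \<subseteq> {\<omega> \<in> space M. x < \<bar>?S n \<omega>\<bar>}"
  proof safe
    fix \<omega> k assume "k \<le> n" "\<omega> \<in> T k" "\<omega> \<in> D k"
    moreover have "?S n \<omega> = ?S k \<omega> + (\<Sum>i\<in>{k..<n}. X i \<omega>)"
      using \<open>k \<le> n\<close> by (metis atLeast0LessThan sum.atLeastLessThan_concat zero_le)
    ultimately show "x < \<bar>?S n \<omega>\<bar>" by (auto simp: T_def D_def)
  qed (auto simp: T_def)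
  have "prob {\<omega> \<in> space M. \<exists>k\<le>n. 2 * x < \<bar>?S k \<omega>\<bar>} = (\<Sum>k\<le>n. prob (T k))"
    unfolding cover by (intro finite_measure_finite_Union disj) (use T_ev in auto)
  also have "\<dots> \<le> (\<Sum>k\<le>n. 2 * prob (T k \<inter> D k))"
  proof (intro sum_mono)
    fix k assume "k \<in> {..n}"
    then show "prob (T k) \<le> 2 * prob (T k \<inter> D k)"
      using Dhalf[of k] mult_left_mono[of "1/2" "prob (D k)" "prob (T k)"] by (simp add: indep)
  qed
  also have "\<dots> = 2 * (\<Sum>k\<le>n. prob (T k \<inter> D k))" by (simp add: sum_distrib_left)
  also have "(\<Sum>k\<le>n. prob (T k \<inter> D k)) = prob (\<Union>k\<in>{..n}. T k \<inter> D k)"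
    using disj T_ev D_ev
    by (intro finite_measure_finite_Union[symmetric]) (auto simp: disjoint_family_on_def)
  also have "\<dots> \<le> prob {\<omega> \<in> space M. x < \<bar>?S n \<omega>\<bar>}"
    by (intro finite_measure_mono sub) measurable
  finally show ?thesis by simp
qed

locale stable_process = prob_space M for M :: "'a measure" +
  fixes \<alpha> :: real and Y :: "real \<Rightarrow> 'a \<Rightarrow> real"
  assumes \<alpha>: "0 < \<alpha>" "\<alpha> < 2"
    and start: "Y 0 \<omega> = 0"
    and increment: "0 \<le> s \<Longrightarrow> s \<le> t \<Longrightarrow> symmetric_stable \<alpha> (t - s) (\<lambda>\<omega>. Y t \<omega> - Y s \<omega>)"
    and indep: "0 \<le> \<tau> (0::nat) \<Longrightarrow> (\<And>i. i < n \<Longrightarrow> \<tau> i \<le> \<tau> (Suc i)) \<Longrightarrow>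
      indep_vars (\<lambda>_. borel) (\<lambda>i \<omega>. Y (\<tau> (Suc i)) \<omega> - Y (\<tau> i) \<omega>) {..<n}"
    and right_continuous: "AE \<omega> in M. \<forall>t\<ge>0. ((\<lambda>s. Y s \<omega>) \<longlongrightarrow> Y t \<omega>) (at_right t)"
begin

lemma value_stable: "0 \<le> t \<Longrightarrow> symmetric_stable \<alpha> t (Y t)"
  using increment[of 0 t] by (simp add: start)

lemma measurable_Y[measurable (raw)]: "0 \<le> t \<Longrightarrow> random_variable borel (Y t)"
  using value_stable by (blast intro: symmetric_stable_measurable)

text \<open>
Ottaviani's inequality at the points of a grid. Its hypothesis on the remaining sums follows
from the tail bound if \<open>8 t x\<^sup>-\<^sup>\<alpha> \<le> 1/2\<close>; otherwise the claimed bound is at least \<open>1\<close>. The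
bound does not depend on the mesh.
\<close>

lemma grid_maximal_inequality:
  fixes n :: nat
  assumes "0 < t" "0 < x" "0 < n"
  shows "prob {\<omega> \<in> space M. \<exists>k\<le>n. 2 * x < \<bar>Y (real k * t / real n) \<omega>\<bar>} \<le> 16 * (t * x powr - \<alpha>)"
proof (cases "8 * (t * x powr - \<alpha>) \<le> 1 / 2")
  case False
  have "prob {\<omega> \<in> space M. \<exists>k\<le>n. 2 * x < \<bar>Y (real k * t / real n) \<omega>\<bar>} \<le> 1" by (rule prob_le_1)
  then show ?thesis using False by linarith
next
  case True
  define \<tau> where "\<tau> i = real i * t / real n" for i :: nat
  have \<tau>: "0 \<le> \<tau> i" "\<tau> i \<le> \<tau> (Suc i)" for i
    using assms by (simp_all add: \<tau>_def divide_right_mono)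
  have \<tau>0: "\<tau> 0 = 0" and \<tau>n: "\<tau> n = t" using assms by (simp_all add: \<tau>_def)
  have \<tau>le: "\<tau> k \<le> t" if "k \<le> n" for k
    using that assms by (simp add: \<tau>_def field_simps)
  let ?X = "\<lambda>i \<omega>. Y (\<tau> (Suc i)) \<omega> - Y (\<tau> i) \<omega>"
  have tail: "prob {\<omega> \<in> space M. x < \<bar>Y t \<omega> - Y (\<tau> k) \<omega>\<bar>} \<le> 8 * (t * x powr - \<alpha>)" if "k \<le> n" for k
  proof -
    have "prob {\<omega> \<in> space M. x < \<bar>Y t \<omega> - Y (\<tau> k) \<omega>\<bar>} \<le> 8 * ((t - \<tau> k) * x powr - \<alpha>)"
      using \<tau>[of k] \<tau>le[OF that] \<alpha> \<open>0 < x\<close>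
      by (intro symmetric_stable_tail_le increment) auto
    also have "\<dots> \<le> 8 * (t * x powr - \<alpha>)"
      using \<tau>[of k] by (intro mult_left_mono mult_right_mono) auto
    finally show ?thesis .
  qed
  have tele: "(\<Sum>i<k. ?X i \<omega>) = Y (\<tau> k) \<omega>" for k \<omega>
    using sum_lessThan_telescope[of "\<lambda>i. Y (\<tau> i) \<omega>" k] by (simp add: \<tau>0 start)
  have tele': "(\<Sum>i\<in>{k..<n}. ?X i \<omega>) = Y t \<omega> - Y (\<tau> k) \<omega>" if "k \<le> n" for k \<omega>
    using sum_Suc_diff'[OF that, of "\<lambda>i. Y (\<tau> i) \<omega>"] by (simp add: \<tau>n)
  have "prob {\<omega> \<in> space M. \<exists>k\<le>n. 2 * x < \<bar>\<Sum>i<k. ?X i \<omega>\<bar>}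
      \<le> 2 * prob {\<omega> \<in> space M. x < \<bar>\<Sum>i<n. ?X i \<omega>\<bar>}"
  proof (rule ottaviani)
    show "indep_vars (\<lambda>_. borel) ?X {..<n}" using \<tau> by (intro indep) auto
    fix k assume "k \<le> n"
    then show "prob {\<omega> \<in> space M. x < \<bar>\<Sum>i\<in>{k..<n}. ?X i \<omega>\<bar>} \<le> 1 / 2"
      using tail[of k] True by (simp add: tele')
  qed
  also have "\<dots> \<le> 2 * (8 * (t * x powr - \<alpha>))"
    using tail[of 0] by (simp only: tele \<tau>n \<tau>0 start diff_zero) simp
  finally show ?thesis by (simp add: tele) (simp add: \<tau>_def)
qed

text \<open>
The dyadic grids increase, so the uniform bound passes to their union, and right-continuity
extends it to all times before \<open>t\<close>. The supremum over uncountably many times need not be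
measurable; hence an event \<open>E\<close> outside which the path is bounded, rather than the
probability of the supremum.
\<close>

lemma running_maximum_event:
  assumes "0 < t" "0 < x"
  obtains E where "E \<in> events" "prob E \<le> 16 * (t * x powr - \<alpha>)"
    "AE \<omega> in M. \<omega> \<notin> E \<longrightarrow> (\<forall>s\<in>{0..<t}. \<bar>Y s \<omega>\<bar> \<le> 2 * x)"
proof -
  define G where "G m = {\<omega> \<in> space M. \<exists>k\<le>2 ^ m. 2 * x < \<bar>Y (real k * t / 2 ^ m) \<omega>\<bar>}" for m :: nat
  have G_ev: "G m \<in> events" for m
  proof -
    have "G m = {\<omega> \<in> space M. \<exists>k\<in>{..2 ^ m}. 2 * x < \<bar>Y (real k * t / 2 ^ m) \<omega>\<bar>}"
      by (auto simp: G_def)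
    also have "\<dots> \<in> events" using \<open>0 < t\<close>
      by (intro sets.sets_Collect_finite_Ex) auto
    finally show ?thesis .
  qed
  have inc: "incseq G"
  proof (rule incseq_SucI, rule subsetI)
    fix m \<omega> assume "\<omega> \<in> G m"
    then obtain k :: nat where k: "\<omega> \<in> space M" "k \<le> 2 ^ m" "2 * x < \<bar>Y (real k * t / 2 ^ m) \<omega>\<bar>"
      by (auto simp: G_def)
    moreover have "real (2 * k) * t / 2 ^ Suc m = real k * t / 2 ^ m" by simp
    ultimately show "\<omega> \<in> G (Suc m)"
      unfolding G_def by (intro CollectI conjI exI[of _ "2 * k"]) auto
  qed
  have lim: "(\<lambda>m. prob (G m)) \<longlonglongrightarrow> prob (\<Union>m. G m)"
    using G_ev inc by (intro finite_Lim_measure_incseq) auto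
  have "prob (\<Union>m. G m) \<le> 16 * (t * x powr - \<alpha>)"
  proof (rule LIMSEQ_le_const2[OF lim], intro exI allI impI)
    show "prob (G m) \<le> 16 * (t * x powr - \<alpha>)" for m
      using grid_maximal_inequality[OF assms, of "2 ^ m"] by (simp add: G_def)
  qed
  moreover have "AE \<omega> in M. \<omega> \<notin> (\<Union>m. G m) \<longrightarrow> (\<forall>s\<in>{0..<t}. \<bar>Y s \<omega>\<bar> \<le> 2 * x)"
    using right_continuous AE_space
  proof eventually_elim
    case (elim \<omega>)
    show ?case
    proof (intro impI ballI)
      fix s assume "\<omega> \<notin> (\<Union>m. G m)" and s: "s \<in> {0..<t}"
      then have grid: "\<bar>Y (real k * t / 2 ^ m) \<omega>\<bar> \<le> 2 * x" if "k \<le> 2 ^ m" for k m :: nat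
        using that elim by (force simp: G_def not_less)
      \<comment> \<open>the first grid point strictly to the right of \<open>s\<close>\<close>
      define k where "k m = nat \<lfloor>s * 2 ^ m / t\<rfloor> + 1" for m :: nat
      define r where "r m = real (k m) * t / 2 ^ m" for m :: nat
      have kr: "s * 2 ^ m / t < real (k m)" "real (k m) \<le> s * 2 ^ m / t + 1" for m
      proof -
        have "0 \<le> s * 2 ^ m / t" using s \<open>0 < t\<close> by simp
        then have "real (k m) = of_int \<lfloor>s * 2 ^ m / t\<rfloor> + 1" by (simp add: k_def)
        then show "s * 2 ^ m / t < real (k m)" "real (k m) \<le> s * 2 ^ m / t + 1" by linarith+
      qed
      have r_gt: "s < r m" and r_le: "r m \<le> s + t / 2 ^ m" for m
        using kr[of m] \<open>0 < t\<close> by (simp_all add: r_def field_simps)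
      have k_le: "k m \<le> 2 ^ m" for m
      proof -
        have "s * 2 ^ m / t < 2 ^ m" using s \<open>0 < t\<close> by (simp add: field_simps)
        then have "\<lfloor>s * 2 ^ m / t\<rfloor> < 2 ^ m" by (simp add: floor_less_iff)
        moreover have "0 \<le> \<lfloor>s * 2 ^ m / t\<rfloor>" using s \<open>0 < t\<close> by simp
        ultimately have "nat \<lfloor>s * 2 ^ m / t\<rfloor> < 2 ^ m" by (subst nat_less_iff) auto
        then show ?thesis unfolding k_def by (simp only: Suc_eq_plus1[symmetric] Suc_le_eq)
      qed
      have "(\<lambda>m. t * (1 / 2) ^ m) \<longlonglongrightarrow> t * 0"
        by (intro tendsto_mult tendsto_const LIMSEQ_power_zero) simp
      then have "(\<lambda>m. s + t * (1 / 2) ^ m) \<longlonglongrightarrow> s + 0" by (intro tendsto_add tendsto_const) simp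
      then have up: "(\<lambda>m. s + t / 2 ^ m) \<longlonglongrightarrow> s" by (simp add: power_divide)
      have "r \<longlonglongrightarrow> s"
      proof (rule tendsto_sandwich[OF _ _ tendsto_const up])
        show "\<forall>\<^sub>F m in sequentially. s \<le> r m" using r_gt by (intro always_eventually allI less_imp_le)
        show "\<forall>\<^sub>F m in sequentially. r m \<le> s + t / 2 ^ m" using r_le by (intro always_eventually allI)
      qed
      then have "filterlim r (at_right s) sequentially"
        using r_gt by (auto simp: filterlim_at intro!: always_eventually dest: less_imp_neq)
      then have "(\<lambda>m. Y (r m) \<omega>) \<longlonglongrightarrow> Y s \<omega>"
        using elim s by (auto intro: filterlim_compose[of "\<lambda>s. Y s \<omega>"])
      then have "(\<lambda>m. \<bar>Y (r m) \<omega>\<bar>) \<longlonglongrightarrow> \<bar>Y s \<omega>\<bar>" by (rule tendsto_rabs)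
      then show "\<bar>Y s \<omega>\<bar> \<le> 2 * x"
        by (rule LIMSEQ_le_const2) (use grid[OF k_le] in \<open>auto simp: r_def\<close>)
    qed
  qed
  moreover have "(\<Union>m. G m) \<in> events" using G_ev by auto
  ultimately show thesis using that by blast
qed

end

section \<open>The integral as a dyadic series\<close>

text \<open>
Cauchy condensation at the origin: on \<open>]2\<^sup>-\<^sup>n\<^sup>-\<^sup>1, 2\<^sup>-\<^sup>n]\<close> the function lies between its
values at the end points, so the integral is squeezed between two step functions whose
integrals are the series and its shift.
\<close>

lemma antimono_integral_finite_iff_dyadic_summable:
  fixes g :: "real \<Rightarrow> real"
  assumes nonneg: "\<And>t. 0 < t \<Longrightarrow> 0 \<le> g t"
    and anti: "antimono_on {0<..} g"
  shows "(\<integral>\<^sup>+ t \<in> {0<..1}. ennreal (g t) \<partial>lborel) < \<infinity> \<longleftrightarrow>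
    summable (\<lambda>n. (1/2) ^ n * g ((1/2) ^ n))"
proof -
  let ?d = "\<lambda>n::nat. (1/2::real) ^ n"
  define I where "I n = {?d (Suc n)<..?d n}" for n
  have d: "0 < ?d n" "?d n \<le> 1" for n by (auto intro: power_le_one)
  have step: "(\<integral>\<^sup>+ t. (\<Sum>n. ennreal (c n) * indicator (I n) t) \<partial>lborel) = (\<Sum>n. ennreal (c n * ?d (Suc n)))"
    if "\<And>n. 0 \<le> c n" for c :: "nat \<Rightarrow> real"
  proof -
    have "(\<integral>\<^sup>+ t. (\<Sum>n. ennreal (c n) * indicator (I n) t) \<partial>lborel)
        = (\<Sum>n. \<integral>\<^sup>+ t. ennreal (c n) * indicator (I n) t \<partial>lborel)"
      by (intro nn_integral_suminf) (auto simp: I_def)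
    also have "\<dots> = (\<Sum>n. ennreal (c n * ?d (Suc n)))"
      using that d by (intro suminf_cong) (simp add: I_def nn_integral_cmult_indicator ennreal_mult[symmetric])
    finally show ?thesis .
  qed
  have single: "(\<Sum>n. ennreal (c n) * indicator (I n) t) = ennreal (c m)" if "t \<in> I m" for c :: "nat \<Rightarrow> real" and t m
  proof -
    have "t \<notin> I n" if "n \<noteq> m" for n
    proof
      assume "t \<in> I n"
      show False
      proof (cases "n < m")
        case True
        then have "?d m \<le> ?d (Suc n)" by (intro power_decreasing) auto
        then show ?thesis using \<open>t \<in> I n\<close> \<open>t \<in> I m\<close> by (auto simp: I_def)
      next
        case False
        then have "?d n \<le> ?d (Suc m)" using \<open>n \<noteq> m\<close> by (intro power_decreasing) auto
        then show ?thesis using \<open>t \<in> I n\<close> \<open>t \<in> I m\<close> by (auto simp: I_def)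
      qed
    qed
    then have "(\<Sum>n. ennreal (c n) * indicator (I n) t) = (\<Sum>n\<in>{m}. ennreal (c n) * indicator (I n) t)"
      by (intro suminf_finite) auto
    then show ?thesis using that by simp
  qed
  have cover: "\<exists>m. t \<in> I m" if t: "t \<in> {0<..1}" for t
  proof -
    obtain N where "?d N < t" using real_arch_pow_inv[of t "1/2"] t by auto
    then have ex: "\<exists>n. ?d n < t" by blast
    define n where "n = (LEAST n. ?d n < t)"
    have n: "?d n < t" unfolding n_def by (rule LeastI_ex[OF ex])
    then obtain m where m: "n = Suc m" using t by (cases n) auto
    have "\<not> ?d m < t" using not_less_Least[of m "\<lambda>n. ?d n < t"] m by (simp add: n_def)
    then show ?thesis using n m by (auto simp: I_def)
  qed
  have I_sub: "I m \<subseteq> {0<..1}" for m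
    using less_trans[OF d(1)[of "Suc m"]] d(2)[of m] by (auto simp: I_def simp del: power_Suc)
  have notin: "t \<notin> I n" if "t \<notin> {0<..1}" for t n
    using that I_sub by blast
  have zero: "(\<Sum>n. ennreal (c n) * indicator (I n) t) = 0" if "t \<notin> {0<..1}" for c :: "nat \<Rightarrow> real" and t
    using notin[OF that] by (intro suminf_finite[of "{}", simplified]) simp
  let ?I = "\<integral>\<^sup>+ t \<in> {0<..1}. ennreal (g t) \<partial>lborel"
  have g_le: "g t \<le> g s" if "0 < s" "s \<le> t" for s t
    using anti that by (auto simp: monotone_on_def)
  have lower: "(\<Sum>n. ennreal (g (?d n) * ?d (Suc n))) \<le> ?I"
  proof -
    have "(\<Sum>n. ennreal (g (?d n) * ?d (Suc n))) = (\<integral>\<^sup>+ t. (\<Sum>n. ennreal (g (?d n)) * indicator (I n) t) \<partial>lborel)"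
      using nonneg d by (intro step[symmetric]) auto
    also have "\<dots> \<le> ?I"
    proof (intro nn_integral_mono)
      fix t :: real
      show "(\<Sum>n. ennreal (g (?d n)) * indicator (I n) t) \<le> ennreal (g t) * indicator {0<..1} t"
      proof (cases "t \<in> {0<..1}")
        case True
        then obtain m where m: "t \<in> I m" using cover by blast
        then have "ennreal (g (?d m)) \<le> ennreal (g t)"
          using True by (intro ennreal_leI g_le) (auto simp: I_def)
        then show ?thesis using True by (simp add: single[OF m])
      qed (simp add: zero)
    qed
    finally show ?thesis .
  qed
  have upper: "?I \<le> (\<Sum>n. ennreal (g (?d (Suc n)) * ?d (Suc n)))"
  proof -
    have "?I \<le> (\<integral>\<^sup>+ t. (\<Sum>n. ennreal (g (?d (Suc n))) * indicator (I n) t) \<partial>lborel)"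
    proof (intro nn_integral_mono)
      fix t :: real
      show "ennreal (g t) * indicator {0<..1} t \<le> (\<Sum>n. ennreal (g (?d (Suc n))) * indicator (I n) t)"
      proof (cases "t \<in> {0<..1}")
        case True
        then obtain m where m: "t \<in> I m" using cover by blast
        then have "ennreal (g t) \<le> ennreal (g (?d (Suc m)))"
          using d(1)[of "Suc m"] by (intro ennreal_leI g_le) (auto simp: I_def)
        then show ?thesis using True by (simp add: single[OF m] del: power_Suc)
      qed simp
    qed
    also have "\<dots> = (\<Sum>n. ennreal (g (?d (Suc n)) * ?d (Suc n)))"
      using nonneg d(1) by (intro step) blast
    finally show ?thesis .
  qed
  show ?thesis
  proof
    assume "?I < \<infinity>"
    with lower have "(\<Sum>n. ennreal (g (?d n) * ?d (Suc n))) < \<infinity>" by (rule le_less_trans)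
    then have "summable (\<lambda>n. g (?d n) * ?d (Suc n))"
      by (intro summable_suminf_not_top mult_nonneg_nonneg nonneg d(1) less_imp_le[OF d(1)]) (simp only: infinity_ennreal_def less_imp_neq not_False_eq_True)
    then have "summable (\<lambda>n. 2 * (g (?d n) * ?d (Suc n)))" by (rule summable_mult)
    then show "summable (\<lambda>n. ?d n * g (?d n))" by (simp add: mult.commute)
  next
    assume "summable (\<lambda>n. ?d n * g (?d n))"
    then have "summable (\<lambda>n. ?d (Suc n) * g (?d (Suc n)))" by (subst summable_Suc_iff)
    then have "summable (\<lambda>n. g (?d (Suc n)) * ?d (Suc n))" by (simp only: mult.commute)
    then have "(\<Sum>n. ennreal (g (?d (Suc n)) * ?d (Suc n)))
        = ennreal (\<Sum>n. g (?d (Suc n)) * ?d (Suc n))"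
      by (intro suminf_ennreal2 mult_nonneg_nonneg nonneg d(1) less_imp_le[OF d(1)])
    then have "(\<Sum>n. ennreal (g (?d (Suc n)) * ?d (Suc n))) < \<infinity>" by (simp only: ennreal_less_top infinity_ennreal_def)
    with upper show "?I < \<infinity>" by (rule le_less_trans)
  qed
qed

section \<open>Convergent case: the process is small near zero\<close>

lemma dyadic_bracket:
  fixes u :: real
  assumes "0 < u" "u < 1"
  obtains n where "(1/2) ^ n \<le> u" "u < 2 * (1/2) ^ n"
proof -
  obtain N where "(1/2) ^ N < u"
    using real_arch_pow_inv[of u "1/2"] assms by auto
  then have ex: "\<exists>n. (1/2) ^ n \<le> u" by (auto intro: less_imp_le)
  define n where "n = (LEAST n. (1/2) ^ n \<le> u)"
  have n: "(1/2) ^ n \<le> u" unfolding n_def by (rule LeastI_ex[OF ex])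
  have "n \<noteq> 0" using n assms by (cases n) auto
  then obtain m where m: "n = Suc m" by (cases n) auto
  have "\<not> (1/2) ^ m \<le> u"
    using not_less_Least[of m "\<lambda>n. (1/2) ^ n \<le> u"] m by (simp add: n_def)
  then show thesis using n m that[of n] by simp
qed

text \<open>
For \<open>2\<^sup>-\<^sup>n \<le> u < 2 \<sqdot> 2\<^sup>-\<^sup>n\<close> the times up to \<open>2 u\<close> lie before \<open>4 \<sqdot> 2\<^sup>-\<^sup>n\<close>, and \<open>f u \<ge>
f(2\<^sup>-\<^sup>n)\<close>. So it suffices that the running maximum up to \<open>4 \<sqdot> 2\<^sup>-\<^sup>n\<close> is eventually below \<open>\<epsilon>
f(2\<^sup>-\<^sup>n)\<close>, which is the first Borel--Cantelli lemma. The range up to \<open>2 u\<close> absorbs the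
distortion of time by the inverse clock.
\<close>

lemma (in stable_process) small_near_zero:
  fixes f :: "real \<Rightarrow> real"
  assumes pos: "\<And>t. 0 < t \<Longrightarrow> 0 < f t"
    and mono: "mono_on {0<..} f"
    and sum: "summable (\<lambda>n. (1/2) ^ n * f ((1/2) ^ n) powr - \<alpha>)"
    and "0 < \<epsilon>"
  shows "AE \<omega> in M. \<forall>\<^sub>F u in at_right 0. \<forall>s\<in>{0..2*u}. \<bar>Y s \<omega>\<bar> \<le> \<epsilon> * f u"
proof -
  let ?d = "\<lambda>n::nat. (1/2::real) ^ n"
  \<comment> \<open>the bound on the running maximum is twice the level in the tail estimate, so the level is halved\<close>
  let ?P = "\<lambda>n E. E \<in> events \<and> prob E \<le> 16 * (4 * ?d n * (\<epsilon> * f (?d n) / 2) powr - \<alpha>) \<and>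
    (AE \<omega> in M. \<omega> \<notin> E \<longrightarrow> (\<forall>s\<in>{0..<4 * ?d n}. \<bar>Y s \<omega>\<bar> \<le> 2 * (\<epsilon> * f (?d n) / 2)))"
  have "\<exists>E. ?P n E" for n
  proof -
    have "0 < 4 * ?d n" "0 < \<epsilon> * f (?d n) / 2" using \<open>0 < \<epsilon>\<close> pos[of "?d n"] by auto
    then show ?thesis by (rule running_maximum_event) blast
  qed
  then have "\<forall>n. \<exists>E. ?P n E" by blast
  from choice[OF this] obtain E where P: "\<forall>n. ?P n (E n)" ..
  have E: "E n \<in> events" "prob (E n) \<le> 16 * (4 * ?d n * (\<epsilon> * f (?d n) / 2) powr - \<alpha>)"
      "AE \<omega> in M. \<omega> \<notin> E n \<longrightarrow> (\<forall>s\<in>{0..<4 * ?d n}. \<bar>Y s \<omega>\<bar> \<le> 2 * (\<epsilon> * f (?d n) / 2))" for n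
    using P[rule_format, of n] by blast+
  have "summable (\<lambda>n. prob (E n))"
  proof (rule summable_comparison_test_ev)
    show "summable (\<lambda>n. 64 * (\<epsilon> / 2) powr - \<alpha> * (?d n * f (?d n) powr - \<alpha>))"
      using sum by (rule summable_mult)
    have "prob (E n) \<le> 64 * (\<epsilon> / 2) powr - \<alpha> * (?d n * f (?d n) powr - \<alpha>)" for n
    proof -
      have "(\<epsilon> * f (?d n) / 2) powr - \<alpha> = (\<epsilon> / 2) powr - \<alpha> * f (?d n) powr - \<alpha>"
        using \<open>0 < \<epsilon>\<close> pos[of "?d n"] powr_mult[of "\<epsilon> / 2" "f (?d n)" "- \<alpha>"] by simp
      then show ?thesis using E(2)[of n] by (simp add: ac_simps)
    qed
    then show "\<forall>\<^sub>F n in sequentially. norm (prob (E n)) \<le> 64 * (\<epsilon> / 2) powr - \<alpha> * (?d n * f (?d n) powr - \<alpha>)"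
      by simp
  qed
  then have "AE \<omega> in M. \<forall>\<^sub>F n in sequentially. \<omega> \<in> space M - E n"
    using E(1) by (intro borel_cantelli_AE1) (auto simp: emeasure_eq_measure)
  moreover have "AE \<omega> in M. \<forall>n. \<omega> \<notin> E n \<longrightarrow> (\<forall>s\<in>{0..<4 * ?d n}. \<bar>Y s \<omega>\<bar> \<le> 2 * (\<epsilon> * f (?d n) / 2))"
    using E(3) by (simp add: AE_all_countable)
  ultimately show ?thesis
  proof eventually_elim
    case (elim \<omega>)
    then obtain N where N: "\<And>n. N \<le> n \<Longrightarrow> \<omega> \<notin> E n"
      by (auto simp: eventually_sequentially)
    show ?case
    proof (rule eventually_at_rightI[of 0 "?d N"])
      fix u assume u: "u \<in> {0<..<?d N}"
      moreover have "?d N \<le> 1" by (intro power_le_one) auto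
      ultimately obtain n where n: "?d n \<le> u" "u < 2 * ?d n" by (auto intro: dyadic_bracket)
      have "?d n < ?d N" using n(1) u by (intro le_less_trans[OF n(1)]) simp
      then have "N \<le> n" by simp
      show "\<forall>s\<in>{0..2*u}. \<bar>Y s \<omega>\<bar> \<le> \<epsilon> * f u"
      proof
        fix s assume "s \<in> {0..2*u}"
        then have "s \<in> {0..<4 * ?d n}" using n by auto
        then have "\<bar>Y s \<omega>\<bar> \<le> 2 * (\<epsilon> * f (?d n) / 2)" using elim N[OF \<open>N \<le> n\<close>] by blast
        also have "\<dots> = \<epsilon> * f (?d n)" by simp
        also have "\<dots> \<le> \<epsilon> * f u"
          using mono_onD[OF mono, of "?d n" u] n(1) u \<open>0 < \<epsilon>\<close> by (intro mult_left_mono) auto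
        finally show "\<bar>Y s \<omega>\<bar> \<le> \<epsilon> * f u" .
      qed
    qed simp
  qed
qed

section \<open>Independent sequences: Borel--Cantelli and a zero--one law\<close>

text \<open>
The second Borel--Cantelli lemma, from \<open>1 - p \<le> exp (- p)\<close>.
\<close>

lemma (in prob_space) borel_cantelli_independent:
  fixes E :: "nat \<Rightarrow> 'a set"
  assumes ind: "indep_events E UNIV" and div: "\<not> summable (\<lambda>n. prob (E n))"
  shows "AE \<omega> in M. \<exists>\<^sub>F n in sequentially. \<omega> \<in> E n"
proof -
  let ?C = "\<lambda>n. space M - E n"
  have ev: "E n \<in> events" for n using ind by (auto simp: indep_events_def)
  have "indep_sets (\<lambda>i. sigma_sets (space M) {E i}) UNIV"
    using ind by (intro indep_sets_sigma) (auto simp: indep_events_def_alt Int_stable_def)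
  then have "indep_sets (\<lambda>i. {?C i}) UNIV"
    by (rule indep_sets_mono_sets) (auto intro: sigma_sets.intros)
  then have indC: "indep_events ?C UNIV" by (simp add: indep_events_def_alt)
  have null: "prob (\<Inter>k\<in>{m..}. ?C k) = 0" for m
  proof (rule ccontr)
    let ?q = "prob (\<Inter>k\<in>{m..}. ?C k)"
    assume "?q \<noteq> 0"
    then have q: "0 < ?q" by (simp add: zero_less_measure_iff)
    have bound: "(\<Sum>i<N. prob (E (i + m))) \<le> - ln ?q" for N
    proof (cases "N = 0")
      case True
      then show ?thesis using q by simp
    next
      case False
      have "?q \<le> prob (\<Inter>k\<in>{m..<m + N}. ?C k)"
        using False ev by (intro finite_measure_mono sets.finite_INT) auto
      also have "\<dots> = (\<Prod>k\<in>{m..<m + N}. prob (?C k))"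
        using indC False unfolding indep_events_def by auto
      also have "\<dots> \<le> (\<Prod>k\<in>{m..<m + N}. exp (- prob (E k)))"
      proof (intro prod_mono conjI)
        show "prob (?C k) \<le> exp (- prob (E k))" for k
          using exp_ge_add_one_self[of "- prob (E k)"] by (simp add: prob_compl ev)
      qed simp
      also have "\<dots> = exp (- (\<Sum>k\<in>{m..<m + N}. prob (E k)))"
        by (simp add: exp_sum sum_negf[symmetric])
      also have "(\<Sum>k\<in>{m..<m + N}. prob (E k)) = (\<Sum>i<N. prob (E (i + m)))"
        using sum.shift_bounds_nat_ivl[of "\<lambda>k. prob (E k)" 0 m N]
        by (simp add: add.commute atLeast0LessThan)
      finally have "?q \<le> exp (- (\<Sum>i<N. prob (E (i + m))))" .
      then have "ln ?q \<le> ln (exp (- (\<Sum>i<N. prob (E (i + m)))))"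
        using q by (subst ln_le_cancel_iff) auto
      then show ?thesis by simp
    qed
    have "summable (\<lambda>i. prob (E (i + m)))"
      by (rule summableI_nonneg_bounded[OF _ bound]) simp
    then have "summable (\<lambda>n. prob (E n))" by (rule summable_iff_shift[of "\<lambda>n. prob (E n)" m, THEN iffD1])
    with div show False by contradiction
  qed
  have "AE \<omega> in M. \<forall>m. \<omega> \<notin> (\<Inter>k\<in>{m..}. ?C k)"
    unfolding AE_all_countable
  proof
    fix m
    have "(\<Inter>k\<in>{m..}. ?C k) \<in> events" using ev by (intro sets.countable_INT') auto
    then show "AE \<omega> in M. \<omega> \<notin> (\<Inter>k\<in>{m..}. ?C k)"
      using null[of m] by (intro AE_not_in) (simp add: null_sets_def emeasure_eq_measure)
  qed
  then show ?thesis using AE_space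
  proof eventually_elim
    case (elim \<omega>)
    then show ?case by (auto simp: frequently_sequentially)
  qed
qed

lemma (in prob_space) indep_sets_reindex:
  assumes "inj_on h I" "indep_sets (\<lambda>i. F (h i)) I"
  shows "indep_sets F (h ` I)"
  unfolding indep_sets_def
proof (intro conjI ballI allI impI)
  show "F i \<subseteq> events" if "i \<in> h ` I" for i
    using assms(2) that by (auto simp: indep_sets_def)
  fix J A assume J: "J \<subseteq> h ` I" "J \<noteq> {}" "finite J" and A: "A \<in> Pi J F"
  from J(1) obtain J' where J': "J' \<subseteq> I" "J = h ` J'" by (auto simp: subset_image_iff)
  then have inj: "inj_on h J'" using assms(1) by (blast intro: inj_on_subset)
  have "prob (\<Inter>j\<in>J'. A (h j)) = (\<Prod>j\<in>J'. prob (A (h j)))"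
    using J J' A inj by (intro indep_setsD[OF assms(2)]) (auto simp: finite_image_iff)
  then show "prob (\<Inter>j\<in>J. A j) = (\<Prod>j\<in>J. prob (A j))"
    using J' inj by (simp add: prod.reindex)
qed

lemma (in prob_space) indep_vars_reindex:
  assumes "inj_on h I" "indep_vars (\<lambda>i. N (h i)) (\<lambda>i. X (h i)) I"
  shows "indep_vars N X (h ` I)"
  using assms indep_sets_reindex[of h I "\<lambda>i. {X i -` A \<inter> space M |A. A \<in> sets (N i)}"]
  by (auto simp: indep_vars_def2)

lemma (in prob_space) indep_vars_natI:
  fixes X :: "nat \<Rightarrow> 'a \<Rightarrow> 'b"
  assumes "\<And>n. indep_vars N X {..<n}"
  shows "indep_vars N X UNIV"
  unfolding indep_vars_def2
proof (intro conjI ballI)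
  show "random_variable (N i) (X i)" for i
    using assms[of "Suc i"] by (simp add: indep_vars_def2)
  show "indep_sets (\<lambda>i. {X i -` A \<inter> space M |A. A \<in> sets (N i)}) UNIV"
    unfolding indep_sets_finite_index_sets[of _ UNIV]
  proof (intro allI impI)
    fix J :: "nat set" assume "finite J"
    then obtain n where "J \<subseteq> {..<n}" by (meson finite_nat_bounded)
    then show "indep_sets (\<lambda>i. {X i -` A \<inter> space M |A. A \<in> sets (N i)}) J"
      using assms[of n] by (auto simp: indep_vars_def2 intro: indep_sets_mono_index)
  qed
qed

text \<open>
If \<open>x k\<close> is the increment over \<open>[2\<^sup>-\<^sup>k\<^sup>-\<^sup>2, 2\<^sup>-\<^sup>k\<^sup>-\<^sup>1]\<close> of a path tending to \<open>0\<close> at time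
\<open>0\<close>, the inner upper limit is the value of the path at \<open>2\<^sup>-\<^sup>n\<^sup>-\<^sup>1\<close>. Writing that value as an
upper limit of finite sums makes it, for every \<open>x\<close>, a function of the \<open>x k\<close> with \<open>k \<ge> n\<close>, as
exact membership in the tail \<open>\<sigma>\<close>-algebra requires.
\<close>

definition tail_sum_exceeds :: "(nat \<Rightarrow> real) \<Rightarrow> (nat \<Rightarrow> real) \<Rightarrow> bool" where
  "tail_sum_exceeds c x \<longleftrightarrow>
     (\<exists>\<^sub>F n in sequentially. ereal (c n) < limsup (\<lambda>N. ereal (\<Sum>k\<in>{n..<N}. x k)))"

text \<open>
Finitely many terms do not affect the event: only the \<open>x k\<close> with \<open>k \<ge> j\<close> occur on the right.
\<close>

lemma tail_sum_exceeds_drop: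
  "tail_sum_exceeds c x \<longleftrightarrow>
    (\<forall>m. \<exists>i. ereal (c (j + m + i)) < limsup (\<lambda>N. ereal (\<Sum>k\<in>{j + m + i..<N}. x k)))"
  (is "_ \<longleftrightarrow> (\<forall>m. \<exists>i. ?P (j + m + i))")
  unfolding tail_sum_exceeds_def frequently_sequentially
proof safe
  fix m assume "\<forall>m. \<exists>n\<ge>m. ?P n"
  then obtain n where "j + m \<le> n" "?P n" by blast
  then show "\<exists>i. ?P (j + m + i)" by (metis le_add_diff_inverse)
next
  fix m assume "\<forall>m. \<exists>i. ?P (j + m + i)"
  then obtain i where "?P (j + m + i)" by blast
  then show "\<exists>n\<ge>m. ?P n" by (intro exI[of _ "j + m + i"]) simp
qed

lemma measurable_tail_sum_exceeds:
  assumes "\<And>k. j \<le> k \<Longrightarrow> X k \<in> borel_measurable N"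
  shows "{\<omega> \<in> space N. tail_sum_exceeds c (\<lambda>k. X k \<omega>)} \<in> sets N"
proof -
  have "(\<lambda>\<omega>. ereal (\<Sum>k\<in>{j + m + i..<n}. X k \<omega>)) \<in> borel_measurable N" for m i n
    using assms by (intro borel_measurable_ereal borel_measurable_sum) auto
  note [measurable] = this
  show ?thesis unfolding tail_sum_exceeds_drop[of c _ j] by measurable
qed

lemma (in prob_space) tail_sum_exceeds_zero_one:
  assumes "indep_vars (\<lambda>_. borel) X UNIV"
  shows "(AE \<omega> in M. tail_sum_exceeds c (\<lambda>k. X k \<omega>)) \<or> (AE \<omega> in M. \<not> tail_sum_exceeds c (\<lambda>k. X k \<omega>))"
proof -
  let ?A = "\<lambda>i. sigma_sets (space M) {X i -` B \<inter> space M |B. B \<in> sets (borel :: real measure)}"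
  let ?T = "{\<omega> \<in> space M. tail_sum_exceeds c (\<lambda>k. X k \<omega>)}"
  have rv: "random_variable borel (X i)" for i
    using assms by (auto simp: indep_vars_def)
  have T_ev: "?T \<in> events"
    by (rule measurable_tail_sum_exceeds[of 0]) (rule rv)
  have "prob ?T = 0 \<or> prob ?T = 1"
  proof (rule kolmogorov_0_1_law[of ?A])
    show "sigma_algebra (space M) (?A i)" for i
      by (intro sigma_algebra_sigma_sets) auto
    show "indep_sets ?A UNIV" using assms by (simp add: indep_vars_def)
    show "?T \<in> tail_events ?A"
      unfolding tail_events_def
    proof
      fix j
      let ?G = "\<Union>i\<in>{j..}. ?A i"
      have G: "?G \<subseteq> Pow (space M)"
        using sigma_sets_into_sp[of "{X i -` B \<inter> space M |B. B \<in> sets borel}" "space M" for i] by blast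
      have "X k \<in> borel_measurable (sigma (space M) ?G)" if "j \<le> k" for k
      proof (rule measurableI)
        fix B :: "real set" assume "B \<in> sets borel"
        then have "X k -` B \<inter> space M \<in> ?G" using that by (blast intro: sigma_sets.Basic)
        then show "X k -` B \<inter> space (sigma (space M) ?G) \<in> sets (sigma (space M) ?G)"
          using G by (simp add: space_measure_of sets_measure_of sigma_sets.Basic)
      qed simp
      from measurable_tail_sum_exceeds[OF this, where c=c]
      show "?T \<in> sigma_sets (space M) ?G"
        using G by (simp add: space_measure_of sets_measure_of)
    qed
  qed
  then show ?thesis
  proof
    assume "prob ?T = 0"
    then have "AE \<omega> in M. \<omega> \<notin> ?T" using T_ev by (simp add: prob_eq_0)
    then have "AE \<omega> in M. \<not> tail_sum_exceeds c (\<lambda>k. X k \<omega>)"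
      using AE_space by eventually_elim auto
    then show ?thesis ..
  next
    assume "prob ?T = 1"
    then have "AE \<omega> in M. \<omega> \<in> ?T" using T_ev by (simp add: prob_eq_1)
    then have "AE \<omega> in M. tail_sum_exceeds c (\<lambda>k. X k \<omega>)"
      by eventually_elim auto
    then show ?thesis ..
  qed
qed

text \<open>
Independence and symmetry of the single terms make the law of the whole sequence invariant
under a change of sign.
\<close>

lemma (in prob_space) tail_sum_exceeds_uminus:
  assumes ind: "indep_vars (\<lambda>_. borel) X UNIV"
    and sym: "\<And>k. distr M borel (\<lambda>\<omega>. - X k \<omega>) = distr M borel (X k)"
    and ae: "AE \<omega> in M. \<not> tail_sum_exceeds c (\<lambda>k. X k \<omega>)"
  shows "AE \<omega> in M. \<not> tail_sum_exceeds c (\<lambda>k. - X k \<omega>)"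
proof -
  let ?P = "\<Pi>\<^sub>M k\<in>(UNIV::nat set). (borel :: real measure)"
  have rv: "random_variable borel (X k)" for k
    using ind by (auto simp: indep_vars_def)
  have ind': "indep_vars (\<lambda>_. borel) (\<lambda>k \<omega>. - X k \<omega>) UNIV"
    by (rule indep_vars_compose2[OF ind, of "\<lambda>_ x. - x"]) auto
  have law: "distr M ?P (\<lambda>\<omega>. \<lambda>k\<in>UNIV. - X k \<omega>) = distr M ?P (\<lambda>\<omega>. \<lambda>k\<in>UNIV. X k \<omega>)"
    using indep_vars_iff_distr_eq_PiM[where I=UNIV and M'="\<lambda>_. borel" and X=X] ind
      indep_vars_iff_distr_eq_PiM[where I=UNIV and M'="\<lambda>_. borel" and X="\<lambda>k \<omega>. - X k \<omega>"] ind' rv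
    by (simp add: sym)
  have T: "{x \<in> space ?P. \<not> tail_sum_exceeds c (\<lambda>k. x k)} \<in> sets ?P"
    by (intro sets.sets_Collect_neg measurable_tail_sum_exceeds[of 0] measurable_component_singleton) simp
  have mX: "(\<lambda>\<omega>. \<lambda>k\<in>UNIV. X k \<omega>) \<in> measurable M ?P"
    and mX': "(\<lambda>\<omega>. \<lambda>k\<in>UNIV. - X k \<omega>) \<in> measurable M ?P"
    using rv by (auto intro!: measurable_restrict)
  have "AE x in distr M ?P (\<lambda>\<omega>. \<lambda>k\<in>UNIV. X k \<omega>). \<not> tail_sum_exceeds c (\<lambda>k. x k)"
    using ae by (subst AE_distr_iff[OF mX T]) (simp add: restrict_def)
  then have "AE x in distr M ?P (\<lambda>\<omega>. \<lambda>k\<in>UNIV. - X k \<omega>). \<not> tail_sum_exceeds c (\<lambda>k. x k)"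
    by (simp only: law)
  then show ?thesis by (subst (asm) AE_distr_iff[OF mX' T]) (simp add: restrict_def)
qed

section \<open>Divergent case: the process is large near zero\<close>

context stable_process
begin

abbreviation dyadic :: "nat \<Rightarrow> real" where
  "dyadic n \<equiv> (1/2) ^ n"

definition dyadic_increment :: "nat \<Rightarrow> 'a \<Rightarrow> real" where
  "dyadic_increment n \<omega> = Y (dyadic (Suc n)) \<omega> - Y (dyadic (Suc (Suc n))) \<omega>"

lemma dyadic_increment_stable:
  "symmetric_stable \<alpha> (dyadic (Suc (Suc n))) (dyadic_increment n)"
proof -
  have "dyadic (Suc n) - dyadic (Suc (Suc n)) = dyadic (Suc (Suc n))" by simp
  moreover have "symmetric_stable \<alpha> (dyadic (Suc n) - dyadic (Suc (Suc n))) (dyadic_increment n)"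
    unfolding dyadic_increment_def by (rule increment) auto
  ultimately show ?thesis by (simp only:)
qed

text \<open>
Independence is given for increments in increasing order of time, whereas \<open>n\<close> runs towards
time \<open>0\<close>; so each finite block is reversed first.
\<close>

lemma dyadic_increment_indep: "indep_vars (\<lambda>_. borel) dyadic_increment UNIV"
proof (rule indep_vars_natI)
  fix N
  let ?\<tau> = "\<lambda>i. dyadic (Suc N - i)"
  let ?h = "\<lambda>i. N - Suc i"
  have "indep_vars (\<lambda>_. borel) (\<lambda>i \<omega>. Y (?\<tau> (Suc i)) \<omega> - Y (?\<tau> i) \<omega>) {..<N}"
    by (rule indep) (auto intro!: power_decreasing)
  moreover have "(\<lambda>\<omega>. Y (?\<tau> (Suc i)) \<omega> - Y (?\<tau> i) \<omega>) = dyadic_increment (?h i)" if "i < N" for i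
  proof -
    have "Suc N - Suc i = Suc (?h i)" "Suc N - i = Suc (Suc (?h i))" using that by auto
    then show ?thesis by (simp only: dyadic_increment_def fun_eq_iff) simp
  qed
  ultimately have "indep_vars (\<lambda>_. borel) (\<lambda>i. dyadic_increment (?h i)) {..<N}"
    by (subst (asm) indep_vars_cong) (auto intro: refl)
  then have "indep_vars (\<lambda>_. borel) dyadic_increment (?h ` {..<N})"
    by (intro indep_vars_reindex) (auto simp: inj_on_def)
  also have "?h ` {..<N} = {..<N}"
  proof (intro equalityI subsetI)
    fix i assume "i \<in> {..<N}"
    then have "i = ?h (?h i)" "?h i \<in> {..<N}" by auto
    then show "i \<in> ?h ` {..<N}" by (rule image_eqI)
  qed auto
  finally show "indep_vars (\<lambda>_. borel) dyadic_increment {..<N}" .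
qed

text \<open>
The tail bound cuts the terms of the divergent series off at \<open>1\<close>. This keeps divergence: if
the cut-off series converged, its terms would tend to \<open>0\<close> and so eventually be the original
ones.
\<close>

lemma dyadic_increments_exceed:
  fixes c :: "nat \<Rightarrow> real"
  assumes pos: "\<And>n. 0 < c n" and div: "\<not> summable (\<lambda>n. dyadic n * c n powr - \<alpha>)"
  shows "AE \<omega> in M. \<exists>\<^sub>F n in sequentially. c n < dyadic_increment n \<omega>"
proof -
  let ?E = "\<lambda>n. {\<omega> \<in> space M. c n < dyadic_increment n \<omega>}"
  let ?s = "\<lambda>n. dyadic (Suc (Suc n)) * c n powr - \<alpha>"
  define b :: real where "b = ((1/16) powr (1 / (2 - \<alpha>))) powr \<alpha> / 8"
  have b: "0 < b" by (simp add: b_def)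
  have tail: "b / 2 * min 1 (?s n) \<le> prob (?E n)" for n
    using symmetric_stable_tail_ge[OF dyadic_increment_stable[of n] _ pos[of n] \<alpha>]
      symmetric_stable_tail_half[OF dyadic_increment_stable[of n] pos[of n]]
    by (simp add: b_def del: power_Suc)
  have "\<not> summable (\<lambda>n. prob (?E n))"
  proof
    assume "summable (\<lambda>n. prob (?E n))"
    then have "summable (\<lambda>n. b / 2 * min 1 (?s n))"
      using tail b by (rule_tac summable_comparison_test') (auto simp del: power_Suc)
    then have sum: "summable (\<lambda>n. min 1 (?s n))"
      using b by (subst (asm) summable_cmult_iff) auto
    then have "(\<lambda>n. min 1 (?s n)) \<longlonglongrightarrow> 0" by (rule summable_LIMSEQ_zero)
    then have "\<forall>\<^sub>F n in sequentially. min 1 (?s n) < 1"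
      by (rule order_tendstoD) simp
    then have "\<forall>\<^sub>F n in sequentially. min 1 (?s n) = ?s n"
      by eventually_elim (auto simp: min_def split: if_splits)
    then have "summable (\<lambda>n. min 1 (?s n)) \<longleftrightarrow> summable ?s" by (rule summable_cong)
    with sum have "summable ?s" by (simp only:)
    then have "summable (\<lambda>n. 4 * ?s n)" by (rule summable_mult)
    then show False using div by simp
  qed
  then have "AE \<omega> in M. \<exists>\<^sub>F n in sequentially. \<omega> \<in> ?E n"
    by (intro borel_cantelli_independent indep_eventsI_indep_vars[OF dyadic_increment_indep]) auto
  then show ?thesis by eventually_elim simp
qed

lemma dyadic_tail_sums:
  "AE \<omega> in M. \<forall>n. (\<lambda>N. \<Sum>k\<in>{n..<N}. dyadic_increment k \<omega>) \<longlonglongrightarrow> Y (dyadic (Suc n)) \<omega>"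
  using right_continuous
proof eventually_elim
  case (elim \<omega>)
  show ?case
  proof
    fix n
    have "filterlim (\<lambda>N. dyadic (Suc N)) (at_right 0) sequentially"
      unfolding filterlim_at
      by (auto intro!: always_eventually LIMSEQ_Suc LIMSEQ_power_zero simp del: power_Suc)
    moreover have "((\<lambda>s. Y s \<omega>) \<longlongrightarrow> 0) (at_right 0)"
      using elim by (force simp: start)
    ultimately have "(\<lambda>N. Y (dyadic (Suc N)) \<omega>) \<longlonglongrightarrow> 0"
      by (rule filterlim_compose[rotated])
    then have "(\<lambda>N. Y (dyadic (Suc n)) \<omega> - Y (dyadic (Suc N)) \<omega>) \<longlonglongrightarrow> Y (dyadic (Suc n)) \<omega> - 0"
      by (intro tendsto_diff tendsto_const)
    moreover have "\<forall>\<^sub>F N in sequentially. Y (dyadic (Suc n)) \<omega> - Y (dyadic (Suc N)) \<omega>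
        = (\<Sum>k\<in>{n..<N}. dyadic_increment k \<omega>)"
      using eventually_ge_at_top[of n]
    proof eventually_elim
      case (elim N)
      have "(\<Sum>k\<in>{n..<N}. - Y (dyadic (Suc (Suc k))) \<omega> - - Y (dyadic (Suc k)) \<omega>)
          = - Y (dyadic (Suc N)) \<omega> - - Y (dyadic (Suc n)) \<omega>"
        by (rule sum_Suc_diff'[OF elim, of "\<lambda>k. - Y (dyadic (Suc k)) \<omega>"])
      then show ?case by (simp add: dyadic_increment_def del: power_Suc)
    qed
    ultimately show "(\<lambda>N. \<Sum>k\<in>{n..<N}. dyadic_increment k \<omega>) \<longlonglongrightarrow> Y (dyadic (Suc n)) \<omega>"
      by (simp add: tendsto_cong del: power_Suc)
  qed
qed

text \<open>
An increment above \<open>2 K f(2\<^sup>-\<^sup>n)\<close> forces its right end point above \<open>K f(2\<^sup>-\<^sup>n)\<close> or its left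
end point below \<open>- K f(2\<^sup>-\<^sup>n)\<close>, hence below \<open>- K f(2\<^sup>-\<^sup>n\<^sup>-\<^sup>1)\<close>. The two tail events of
positive and negative excursions therefore cover the whole space. By the zero--one law and
symmetry neither can be null, so the first one has probability \<open>1\<close>. The threshold at \<open>2\<^sup>-\<^sup>n\<close>
belongs to the value at \<open>2\<^sup>-\<^sup>n\<^sup>-\<^sup>1\<close> since the clock may double the time.
\<close>

lemma large_near_zero:
  fixes f :: "real \<Rightarrow> real"
  assumes pos: "\<And>t. 0 < t \<Longrightarrow> 0 < f t"
    and mono: "mono_on {0<..} f"
    and div: "\<not> summable (\<lambda>n. dyadic n * f (dyadic n) powr - \<alpha>)"
    and "0 < K"
  shows "AE \<omega> in M. \<exists>\<^sub>F n in sequentially. K * f (dyadic n) < Y (dyadic (Suc n)) \<omega>"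
proof -
  let ?c = "\<lambda>n. K * f (dyadic n)"
  let ?X = "dyadic_increment"
  have fpos: "0 < f (dyadic n)" for n by (simp add: pos)
  have up_iff: "AE \<omega> in M. tail_sum_exceeds ?c (\<lambda>k. ?X k \<omega>) \<longleftrightarrow>
      (\<exists>\<^sub>F n in sequentially. ?c n < Y (dyadic (Suc n)) \<omega>)"
    using dyadic_tail_sums
  proof eventually_elim
    case (elim \<omega>)
    have "limsup (\<lambda>N. ereal (\<Sum>k\<in>{n..<N}. ?X k \<omega>)) = ereal (Y (dyadic (Suc n)) \<omega>)" for n
      using elim by (intro lim_imp_Limsup tendsto_ereal) auto
    then show ?case by (simp add: tail_sum_exceeds_def)
  qed
  have down_iff: "AE \<omega> in M. tail_sum_exceeds ?c (\<lambda>k. - ?X k \<omega>) \<longleftrightarrow>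
      (\<exists>\<^sub>F n in sequentially. ?c n < - Y (dyadic (Suc n)) \<omega>)"
    using dyadic_tail_sums
  proof eventually_elim
    case (elim \<omega>)
    have "(\<lambda>N. \<Sum>k\<in>{n..<N}. - ?X k \<omega>) \<longlonglongrightarrow> - Y (dyadic (Suc n)) \<omega>" for n
      unfolding sum_negf using elim by (intro tendsto_minus) auto
    then have "limsup (\<lambda>N. ereal (\<Sum>k\<in>{n..<N}. - ?X k \<omega>)) = ereal (- Y (dyadic (Suc n)) \<omega>)" for n
      by (intro lim_imp_Limsup tendsto_ereal) auto
    then show ?case by (simp add: tail_sum_exceeds_def)
  qed
  have "\<not> summable (\<lambda>n. dyadic n * (2 * ?c n) powr - \<alpha>)"
  proof
    assume "summable (\<lambda>n. dyadic n * (2 * ?c n) powr - \<alpha>)"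
    moreover have "dyadic n * (2 * ?c n) powr - \<alpha> = (2 * K) powr - \<alpha> * (dyadic n * f (dyadic n) powr - \<alpha>)" for n
      using powr_mult[of "2 * K" "f (dyadic n)" "- \<alpha>"] fpos[of n] \<open>0 < K\<close> by (simp add: ac_simps)
    ultimately show False using div \<open>0 < K\<close> by (simp add: summable_cmult_iff)
  qed
  then have "AE \<omega> in M. \<exists>\<^sub>F n in sequentially. 2 * ?c n < ?X n \<omega>"
    using fpos \<open>0 < K\<close> by (intro dyadic_increments_exceed) auto
  then have either: "AE \<omega> in M. tail_sum_exceeds ?c (\<lambda>k. ?X k \<omega>) \<or> tail_sum_exceeds ?c (\<lambda>k. - ?X k \<omega>)"
    using up_iff down_iff
  proof eventually_elim
    case (elim \<omega>)
    have "?c n < Y (dyadic (Suc n)) \<omega> \<or> ?c (Suc n) < - Y (dyadic (Suc (Suc n))) \<omega>"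
      if "2 * ?c n < ?X n \<omega>" for n
    proof -
      have "f (dyadic (Suc n)) \<le> f (dyadic n)"
        by (rule mono_onD[OF mono]) auto
      then have "?c (Suc n) \<le> ?c n" using \<open>0 < K\<close> by (intro mult_left_mono) auto
      then show ?thesis using that by (simp add: dyadic_increment_def del: power_Suc) linarith
    qed
    with elim(1) have "\<exists>\<^sub>F n in sequentially.
        ?c n < Y (dyadic (Suc n)) \<omega> \<or> ?c (Suc n) < - Y (dyadic (Suc (Suc n))) \<omega>"
      by (rule frequently_mono[rotated, OF _ allI, OF _ impI])
    then have "(\<exists>\<^sub>F n in sequentially. ?c n < Y (dyadic (Suc n)) \<omega>) \<or>
        (\<exists>\<^sub>F n in sequentially. ?c (Suc n) < - Y (dyadic (Suc (Suc n))) \<omega>)"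
      by (simp only: frequently_disj_iff)
    moreover have "(\<exists>\<^sub>F n in sequentially. P (Suc n)) \<longleftrightarrow> (\<exists>\<^sub>F n in sequentially. P n)" for P
      unfolding frequently_def by (simp only: eventually_sequentially_Suc[of "\<lambda>n. \<not> P n"])
    ultimately show ?case using elim(2,3) by blast
  qed
  have "AE \<omega> in M. tail_sum_exceeds ?c (\<lambda>k. ?X k \<omega>)"
  proof (rule ccontr)
    assume "\<not> (AE \<omega> in M. tail_sum_exceeds ?c (\<lambda>k. ?X k \<omega>))"
    then have not_up: "AE \<omega> in M. \<not> tail_sum_exceeds ?c (\<lambda>k. ?X k \<omega>)"
      using tail_sum_exceeds_zero_one[OF dyadic_increment_indep] by blast
    then have "AE \<omega> in M. \<not> tail_sum_exceeds ?c (\<lambda>k. - ?X k \<omega>)"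
      by (rule tail_sum_exceeds_uminus[OF dyadic_increment_indep
            symmetric_stable_distr_uminus[OF dyadic_increment_stable]])
    with not_up either have "AE \<omega> in M. False" by eventually_elim blast
    then show False by simp
  qed
  with up_iff show ?thesis by eventually_elim blast
qed

end

section \<open>The winding of a path near its start\<close>

lemma half_abs_le_abs_sin:
  fixes x :: real
  assumes "\<bar>x\<bar> \<le> 1"
  shows "\<bar>x\<bar> / 2 \<le> \<bar>sin x\<bar>"
proof -
  have pos: "x / 2 \<le> sin x" if x: "0 < x" "x \<le> 1" for x :: real
  proof -
    obtain \<xi> where \<xi>: "0 < \<xi>" "\<xi> < x" "sin x - sin 0 = (x - 0) * cos \<xi>"
      using MVT2[of 0 x sin cos] x by (auto intro: DERIV_sin)
    have "cos (pi / 3) \<le> cos \<xi>"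
      using \<xi> x pi_gt3 by (intro cos_monotone_0_pi_le) auto
    then have "x * (1 / 2) \<le> x * cos \<xi>" using x by (intro mult_left_mono) (auto simp: cos_60)
    then show ?thesis using \<xi> by simp
  qed
  show ?thesis
  proof (cases x "0 :: real" rule: linorder_cases)
    case less
    then have "- x / 2 \<le> sin (- x)" using pos[of "- x"] assms by auto
    then show ?thesis using less by simp
  next
    case greater
    then have "x / 2 \<le> sin x" using pos[of x] assms by auto
    then show ?thesis using greater by simp
  qed simp
qed

text \<open>
The path is the limit of its values at the next point of the grid of mesh \<open>1/(n+1)\<close>, which
depend on the time through an integer only. Measurability of the path is what makes the
clock additive.
\<close>

lemma right_continuous_borel_measurable:
  fixes z :: "real \<Rightarrow> 'b::metric_space"
  assumes rc: "\<And>t. 0 \<le> t \<Longrightarrow> (z \<longlongrightarrow> z t) (at_right t)"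
  shows "z \<in> borel_measurable (restrict_space borel {0..})"
proof (rule borel_measurable_LIMSEQ_metric)
  let ?r = "\<lambda>n t. (of_int \<lfloor>t * real (Suc n)\<rfloor> + 1) / real (Suc n)"
  fix n
  have "(\<lambda>t :: real. \<lfloor>t * real (Suc n)\<rfloor>) \<in> measurable borel (count_space UNIV)"
    by measurable
  then have "(\<lambda>t. z (?r n t)) \<in> borel_measurable borel"
    by (rule measurable_compose[where g = "\<lambda>k. z ((of_int k + 1) / real (Suc n))"]) simp
  then show "(\<lambda>t. z (?r n t)) \<in> borel_measurable (restrict_space borel {0..})"
    by (rule measurable_restrict_space1)
next
  let ?r = "\<lambda>n t. (of_int \<lfloor>t * real (Suc n)\<rfloor> + 1) / real (Suc n)"
  fix t :: real assume "t \<in> space (restrict_space borel {0..})"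
  then have t: "0 \<le> t" by (simp add: space_restrict_space)
  have gt: "t < ?r n t" and le: "?r n t \<le> t + 1 / real (Suc n)" for n
  proof -
    have "t * real (Suc n) < of_int \<lfloor>t * real (Suc n)\<rfloor> + 1"
      "of_int \<lfloor>t * real (Suc n)\<rfloor> + 1 \<le> t * real (Suc n) + 1" by linarith+
    then show "t < ?r n t" "?r n t \<le> t + 1 / real (Suc n)"
      by (simp_all add: pos_less_divide_eq pos_divide_le_eq distrib_right del: of_nat_Suc)
  qed
  have "(\<lambda>n. t + 1 / real (Suc n)) \<longlonglongrightarrow> t + 0"
    using LIMSEQ_inverse_real_of_nat by (intro tendsto_add tendsto_const) (simp add: inverse_eq_divide)
  then have up: "(\<lambda>n. t + 1 / real (Suc n)) \<longlonglongrightarrow> t" by simp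
  have "(\<lambda>n. ?r n t) \<longlonglongrightarrow> t"
  proof (rule tendsto_sandwich[OF _ _ tendsto_const up])
    show "\<forall>\<^sub>F n in sequentially. t \<le> ?r n t" using gt by (intro always_eventually allI less_imp_le)
    show "\<forall>\<^sub>F n in sequentially. ?r n t \<le> t + 1 / real (Suc n)" using le by (intro always_eventually allI)
  qed
  moreover have "?r n t \<in> {t<..}" "?r n t \<noteq> t" for n
    using gt[of n] by (simp_all only: greaterThan_iff less_imp_neq[symmetric] not_False_eq_True)
  ultimately have "filterlim (\<lambda>n. ?r n t) (at_right t) sequentially"
    unfolding filterlim_at by (intro conjI always_eventually allI)
  then show "(\<lambda>n. z (?r n t)) \<longlonglongrightarrow> z t"
    using rc[OF t] by (rule filterlim_compose[rotated])
qed

locale winding_start =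
  fixes \<alpha> :: real and z :: "real \<Rightarrow> complex" and \<theta> :: "real \<Rightarrow> real"
  assumes cadlag: "cadlag z" and start: "z 0 = 1" and winding: "is_winding_path z \<theta>"
begin

abbreviation A :: "real \<Rightarrow> real" where "A \<equiv> inverse_clock \<alpha> z"

text \<open>
At time \<open>0\<close> the values of \<open>|z|\<close> and \<open>\<theta>\<close> are \<open>1\<close> and \<open>0\<close>, so near \<open>0\<close> the comparison follows
from \<open>sin \<theta> = Im z / |z|\<close> and \<open>|x| / 2 \<le> |sin x| \<le> |x|\<close>.
\<close>

lemma near_start:
  obtains \<delta> where "0 < \<delta>"
    "\<And>t. t \<in> {0..<\<delta>} \<Longrightarrow> 1 / 2 \<le> norm (z t) powr - \<alpha>"
    "\<And>t. t \<in> {0..<\<delta>} \<Longrightarrow> norm (z t) powr - \<alpha> \<le> 2"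
    "\<And>t. t \<in> {0..<\<delta>} \<Longrightarrow> \<bar>\<theta> t\<bar> \<le> 4 * \<bar>Im (z t)\<bar>"
    "\<And>t. t \<in> {0..<\<delta>} \<Longrightarrow> 0 \<le> Im (z t) \<Longrightarrow> Im (z t) / 2 \<le> \<theta> t"
proof -
  have \<theta>: "\<theta> 0 = 0" "(\<theta> \<longlongrightarrow> \<theta> 0) (at_right 0)" "\<And>t. 0 \<le> t \<Longrightarrow> cis (\<theta> t) = z t / of_real (norm (z t))"
    using winding by (auto simp: is_winding_path_def cadlag_def)
  have z: "(z \<longlongrightarrow> 1) (at_right 0)"
    using cadlag start unfolding cadlag_def by force
  then have n: "((\<lambda>t. norm (z t)) \<longlongrightarrow> 1) (at_right 0)" using tendsto_norm[OF z] by simp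
  then have p: "((\<lambda>t. norm (z t) powr - \<alpha>) \<longlongrightarrow> 1) (at_right 0)"
    using tendsto_powr[OF n tendsto_const[of "- \<alpha>"]] by simp
  have "\<forall>\<^sub>F t in at_right 0. 1 / 2 < norm (z t) powr - \<alpha> \<and> norm (z t) powr - \<alpha> < 2 \<and>
      1 / 2 < norm (z t) \<and> norm (z t) < 2 \<and> - 1 < \<theta> t \<and> \<theta> t < 1"
    using \<theta>(1,2) by (intro eventually_conj order_tendstoD[OF p] order_tendstoD[OF n] order_tendstoD[of \<theta> 0]) auto
  then obtain \<delta> where \<delta>: "0 < \<delta>" and *: "\<And>t. 0 < t \<Longrightarrow> t < \<delta> \<Longrightarrow> 1 / 2 < norm (z t) powr - \<alpha> \<and> norm (z t) powr - \<alpha> < 2 \<and>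
      1 / 2 < norm (z t) \<and> norm (z t) < 2 \<and> - 1 < \<theta> t \<and> \<theta> t < 1"
    unfolding eventually_at_right_field by blast
  have near: "1 / 2 < norm (z t) powr - \<alpha> \<and> norm (z t) powr - \<alpha> < 2 \<and>
      1 / 2 < norm (z t) \<and> norm (z t) < 2 \<and> - 1 < \<theta> t \<and> \<theta> t < 1" if "t \<in> {0..<\<delta>}" for t
    using *[of t] that start \<theta>(1) by (cases "t = 0") auto
  have sin: "sin (\<theta> t) = Im (z t) / norm (z t)" if "0 \<le> t" for t
    using arg_cong[OF \<theta>(3)[OF that], of Im] by simp
  have bound: "\<bar>\<theta> t\<bar> \<le> 4 * \<bar>Im (z t)\<bar>" if t: "t \<in> {0..<\<delta>}" for t
  proof -
    have "\<bar>\<theta> t\<bar> / 2 \<le> \<bar>sin (\<theta> t)\<bar>" using near[OF t] by (intro half_abs_le_abs_sin) auto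
    also have "\<dots> = \<bar>Im (z t)\<bar> / norm (z t)" using sin t by simp
    also have "\<dots> \<le> \<bar>Im (z t)\<bar> / (1 / 2)" using near[OF t] by (intro divide_left_mono) auto
    finally show ?thesis by simp
  qed
  have pos: "Im (z t) / 2 \<le> \<theta> t" if t: "t \<in> {0..<\<delta>}" and im: "0 \<le> Im (z t)" for t
  proof -
    have s: "0 \<le> sin (\<theta> t)" using sin t im by simp
    have "0 \<le> \<theta> t"
    proof (rule ccontr)
      assume "\<not> 0 \<le> \<theta> t"
      then have "0 < sin (- \<theta> t)" using near[OF t] pi_gt3 by (intro sin_gt_zero) auto
      then show False using s by simp
    qed
    then have "sin (\<theta> t) \<le> \<theta> t" by (rule sin_x_le_x)
    moreover have "Im (z t) / 2 \<le> Im (z t) / norm (z t)"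
      using near[OF t] im by (intro divide_left_mono) auto
    moreover have "sin (\<theta> t) = Im (z t) / norm (z t)" using sin t by simp
    ultimately show ?thesis by linarith
  qed
  show thesis
    using near by (intro that[OF \<delta>] bound pos) (auto intro: less_imp_le)
qed

text \<open>
Near \<open>0\<close> the clock increases at a rate between \<open>1/2\<close> and \<open>2\<close>. Its inverse therefore at most
doubles time and, the clock being strictly increasing, takes every small value \<open>t\<close>, namely
at the clock time of \<open>t\<close>.
\<close>

lemma clock_near_start:
  obtains \<delta> where "0 < \<delta>"
    "\<And>t. t \<in> {0..<\<delta>} \<Longrightarrow> \<bar>\<theta> t\<bar> \<le> 4 * \<bar>Im (z t)\<bar>"
    "\<And>t. t \<in> {0..<\<delta>} \<Longrightarrow> 0 \<le> Im (z t) \<Longrightarrow> Im (z t) / 2 \<le> \<theta> t"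
    "\<And>u. 0 < u \<Longrightarrow> 2 * u < \<delta> \<Longrightarrow> A u \<in> {0..2 * u}"
    "\<And>t. 0 < t \<Longrightarrow> t < \<delta> \<Longrightarrow> \<exists>u>0. u \<le> 2 * t \<and> A u = t"
proof -
  obtain \<delta> where \<delta>: "0 < \<delta>"
      and lo: "\<And>t. t \<in> {0..<\<delta>} \<Longrightarrow> 1 / 2 \<le> norm (z t) powr - \<alpha>"
      and hi: "\<And>t. t \<in> {0..<\<delta>} \<Longrightarrow> norm (z t) powr - \<alpha> \<le> 2"
      and th: "\<And>t. t \<in> {0..<\<delta>} \<Longrightarrow> \<bar>\<theta> t\<bar> \<le> 4 * \<bar>Im (z t)\<bar>"
        "\<And>t. t \<in> {0..<\<delta>} \<Longrightarrow> 0 \<le> Im (z t) \<Longrightarrow> Im (z t) / 2 \<le> \<theta> t"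
    by (rule near_start) blast
  let ?H = "clock \<alpha> z"
  have mono: "?H s \<le> ?H t" if "s \<le> t" for s t
    unfolding clock_def using that by (intro nn_integral_mono mult_left_mono) (auto simp: indicator_def)
  have H_le: "?H t \<le> ennreal (2 * t)" if "t \<in> {0..<\<delta>}" for t
  proof -
    have "?H t \<le> (\<integral>\<^sup>+ s. 2 * indicator {0..t} s \<partial>lborel)"
      unfolding clock_def using that hi
      by (intro nn_integral_mono) (auto simp: indicator_def ennreal_leI simp flip: ennreal_numeral)
    also have "\<dots> = ennreal (2 * t)"
      using that by (simp add: nn_integral_cmult_indicator ennreal_mult)
    finally show ?thesis .
  qed
  have meas: "(\<lambda>s. ennreal (norm (z s) powr - \<alpha>) * indicator {0..t} s) \<in> borel_measurable lborel" for t
  proof -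
    have "z \<in> borel_measurable (restrict_space borel {0..})"
      using cadlag by (intro right_continuous_borel_measurable) (auto simp: cadlag_def)
    then have "z \<in> borel_measurable (restrict_space borel {0..t})"
      by (rule measurable_restrict_mono) auto
    note [measurable] = this
    have "(\<lambda>s. ennreal (norm (z s) powr - \<alpha>)) \<in> borel_measurable (restrict_space borel {0..t})"
      by measurable
    then show ?thesis
      by (subst (asm) borel_measurable_restrict_space_iff_ennreal) simp_all
  qed
  have incr: "?H t + ennreal ((s - t) / 2) \<le> ?H s" if "0 \<le> t" "t \<le> s" "s < \<delta>" for t s
  proof -
    let ?h = "\<lambda>r. ennreal (norm (z r) powr - \<alpha>)"
    have "(\<integral>\<^sup>+ r. ennreal (1/2) * indicator {t<..s} r \<partial>lborel) = ennreal (1/2) * ennreal (s - t)"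
      using that by (subst nn_integral_cmult_indicator) auto
    also have "\<dots> = ennreal ((s - t) / 2)"
      using that by (subst ennreal_mult[symmetric]) auto
    finally have "?H t + ennreal ((s - t) / 2)
        = (\<integral>\<^sup>+ r. ?h r * indicator {0..t} r \<partial>lborel) + (\<integral>\<^sup>+ r. ennreal (1/2) * indicator {t<..s} r \<partial>lborel)"
      by (simp only: clock_def)
    also have "\<dots> = (\<integral>\<^sup>+ r. ?h r * indicator {0..t} r + ennreal (1/2) * indicator {t<..s} r \<partial>lborel)"
      by (intro nn_integral_add[symmetric] meas) auto
    also have "\<dots> \<le> ?H s"
      unfolding clock_def
    proof (rule nn_integral_mono)
      fix r
      consider "r \<in> {0..t}" | "r \<in> {t<..s}" | "r \<notin> {0..t}" "r \<notin> {t<..s}" by blast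
      then show "?h r * indicator {0..t} r + ennreal (1/2) * indicator {t<..s} r \<le> ?h r * indicator {0..s} r"
      proof cases
        case 2
        then have "ennreal (1/2) \<le> ?h r" using that by (intro ennreal_leI lo) auto
        then show ?thesis using 2 that by simp
      qed (use that in auto)
    qed
    finally show ?thesis .
  qed
  have H_ge: "ennreal (t / 2) \<le> ?H t" if "t \<in> {0..<\<delta>}" for t
    using incr[of 0 t] that by (auto intro: order_trans[rotated])
  have bdd: "bdd_below {t. 0 \<le> t \<and> ennreal u < ?H t}" for u
    by (rule bdd_belowI[of _ 0]) simp
  have A_small: "A u \<in> {0..2 * u}" if u: "0 < u" "2 * u < \<delta>" for u
  proof -
    have mem: "t \<in> {t. 0 \<le> t \<and> ennreal u < ?H t}" if "2 * u < t" "t < \<delta>" for t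
    proof -
      have "ennreal u < ennreal (t / 2)" using u that by (intro ennreal_lessI) auto
      also have "\<dots> \<le> ?H t" using u that by (intro H_ge) auto
      finally show ?thesis using u that by simp
    qed
    have "(2 * u + \<delta>) / 2 \<in> {t. 0 \<le> t \<and> ennreal u < ?H t}" using u by (intro mem) auto
    then have "{t. 0 \<le> t \<and> ennreal u < ?H t} \<noteq> {}" by blast
    then have "0 \<le> A u"
      unfolding inverse_clock_def by (rule cInf_greatest) simp
    moreover have "A u \<le> 2 * u"
    proof (rule dense_ge_bounded[OF u(2)])
      show "A u \<le> t" if "2 * u < t" "t < \<delta>" for t
        unfolding inverse_clock_def by (rule cInf_lower[OF mem[OF that] bdd])
    qed
    ultimately show ?thesis by simp
  qed
  have A_onto: "\<exists>u>0. u \<le> 2 * t \<and> A u = t" if t: "0 < t" "t < \<delta>" for t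
  proof -
    define u where "u = enn2real (?H t)"
    have fin: "?H t < \<top>" using H_le[of t] t by (auto intro: le_less_trans)
    then have u: "?H t = ennreal u" by (simp add: u_def)
    have "ennreal (t / 2) \<le> ennreal u" "ennreal u \<le> ennreal (2 * t)"
      using H_ge[of t] H_le[of t] t unfolding u by auto
    then have "t / 2 \<le> u" "u \<le> 2 * t" using t by (auto simp: ennreal_le_iff2)
    moreover have "0 < u" using \<open>t / 2 \<le> u\<close> t by simp
    moreover have "A u = t"
    proof (rule antisym)
      have beyond: "s \<in> {s. 0 \<le> s \<and> ennreal u < ?H s}" if "t < s" "s < \<delta>" for s
      proof -
        have "ennreal u < ennreal (u + (s - t) / 2)"
          using \<open>0 < u\<close> that by (intro ennreal_lessI add_pos_pos) auto
        also have "\<dots> = ?H t + ennreal ((s - t) / 2)"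
          unfolding u by (rule ennreal_plus) (use \<open>0 < u\<close> that in auto)
        also have "\<dots> \<le> ?H s" using that t by (intro incr) auto
        finally show ?thesis using that t by simp
      qed
      show "A u \<le> t"
      proof (rule dense_ge_bounded[OF t(2)])
        show "A u \<le> s" if "t < s" "s < \<delta>" for s
          unfolding inverse_clock_def by (rule cInf_lower[OF beyond[OF that] bdd])
      qed
      have "(t + \<delta>) / 2 \<in> {s. 0 \<le> s \<and> ennreal u < ?H s}" using t by (intro beyond) auto
      then have ne: "{s. 0 \<le> s \<and> ennreal u < ?H s} \<noteq> {}" by blast
      show "t \<le> A u"
        unfolding inverse_clock_def
      proof (rule cInf_greatest[OF ne])
        fix s assume "s \<in> {s. 0 \<le> s \<and> ennreal u < ?H s}"
        then have "?H t < ?H s" by (simp add: u)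
        then have "\<not> ?H s \<le> ?H t" by simp
        then show "t \<le> s" using mono[of s t] by linarith
      qed
    qed
    ultimately show ?thesis using t by (intro exI[of _ u]) auto
  qed
  show thesis using that[OF \<delta> th A_small A_onto] .
qed

end

context winding_start
begin

text \<open>
The ratio tends to \<open>0\<close> in absolute value, so its upper limit is exactly \<open>0\<close>. Rational \<open>\<epsilon>\<close>
suffice, which leaves countably many exceptional null sets in the application.
\<close>

lemma Limsup_eq_0:
  assumes pos: "\<And>t. 0 < t \<Longrightarrow> 0 < f t"
    and small: "\<And>\<epsilon>::real. 0 < \<epsilon> \<Longrightarrow> \<epsilon> \<in> \<rat> \<Longrightarrow> \<forall>\<^sub>F u in at_right 0. \<forall>s\<in>{0..2*u}. \<bar>Im (z s)\<bar> \<le> \<epsilon> * f u"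
  shows "Limsup (at_right 0) (\<lambda>u. ereal (\<theta> (A u) / f u)) = 0"
proof -
  obtain \<delta> where \<delta>: "0 < \<delta>"
      and th: "\<And>t. t \<in> {0..<\<delta>} \<Longrightarrow> \<bar>\<theta> t\<bar> \<le> 4 * \<bar>Im (z t)\<bar>"
      and A: "\<And>u. 0 < u \<Longrightarrow> 2 * u < \<delta> \<Longrightarrow> A u \<in> {0..2 * u}"
    by (rule clock_near_start) blast
  have "((\<lambda>u. \<theta> (A u) / f u) \<longlongrightarrow> 0) (at_right 0)"
  proof (rule tendstoI)
    fix e :: real assume "0 < e"
    then obtain \<epsilon> where \<epsilon>: "\<epsilon> \<in> \<rat>" "0 < \<epsilon>" "\<epsilon> < e / 4" using Rats_dense_in_real[of 0 "e / 4"] by auto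
    have "\<forall>\<^sub>F u in at_right 0. u \<in> {0<..<\<delta> / 2}"
      using \<delta> by (intro eventually_at_rightI[of 0 "\<delta> / 2"]) auto
    then show "\<forall>\<^sub>F u in at_right 0. dist (\<theta> (A u) / f u) 0 < e"
      using small[OF \<epsilon>(2,1)]
    proof eventually_elim
      case (elim u)
      then have u: "0 < u" "2 * u < \<delta>" by auto
      then have "\<bar>\<theta> (A u)\<bar> \<le> 4 * \<bar>Im (z (A u))\<bar>" using A[OF u] by (intro th) auto
      also have "\<dots> \<le> 4 * (\<epsilon> * f u)" using elim A[OF u] by auto
      also have "\<dots> < e * f u" using \<epsilon> pos[OF u(1)] by simp
      finally show ?case using pos[OF u(1)] by (simp add: abs_divide pos_divide_less_eq)
    qed
  qed
  then have "((\<lambda>u. ereal (\<theta> (A u) / f u)) \<longlongrightarrow> ereal 0) (at_right 0)" by (rule tendsto_ereal)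
  then show ?thesis by (simp add: lim_imp_Limsup zero_ereal_def)
qed

text \<open>
The clock time \<open>u\<close> of \<open>t = 2\<^sup>-\<^sup>n\<^sup>-\<^sup>1\<close> is at most \<open>2\<^sup>-\<^sup>n\<close>, so \<open>f u \<le> f(2\<^sup>-\<^sup>n)\<close>, and the
time-changed winding at \<open>u\<close> is the winding at \<open>t\<close>.
\<close>

lemma Limsup_eq_infinity:
  assumes pos: "\<And>t. 0 < t \<Longrightarrow> 0 < f t" and mono: "mono_on {0<..} f"
    and large: "\<And>k::nat. \<exists>\<^sub>F n in sequentially. real (Suc k) * f ((1/2) ^ n) < Im (z ((1/2) ^ Suc n))"
  shows "Limsup (at_right 0) (\<lambda>u. ereal (\<theta> (A u) / f u)) = \<infinity>"
proof (rule ccontr)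
  let ?L = "Limsup (at_right 0) (\<lambda>u. ereal (\<theta> (A u) / f u))"
  obtain \<delta> where \<delta>: "0 < \<delta>"
      and th: "\<And>t. t \<in> {0..<\<delta>} \<Longrightarrow> 0 \<le> Im (z t) \<Longrightarrow> Im (z t) / 2 \<le> \<theta> t"
      and A: "\<And>t. 0 < t \<Longrightarrow> t < \<delta> \<Longrightarrow> \<exists>u>0. u \<le> 2 * t \<and> A u = t"
    by (rule clock_near_start) blast
  assume "?L \<noteq> \<infinity>"
  then obtain C :: nat where "?L < ereal C"
    using less_PInf_Ex_of_nat by auto
  then have "\<forall>\<^sub>F u in at_right 0. ereal (\<theta> (A u) / f u) < ereal C" by (rule Limsup_lessD)
  then obtain b where b: "0 < b" "\<And>u. 0 < u \<Longrightarrow> u < b \<Longrightarrow> \<theta> (A u) / f u < C"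
    unfolding eventually_at_right_field by auto
  have "(\<lambda>n. (1/2::real) ^ n) \<longlonglongrightarrow> 0" by (rule LIMSEQ_power_zero) simp
  then have "\<forall>\<^sub>F n in sequentially. (1/2::real) ^ n < min \<delta> b"
    using \<delta> b by (intro order_tendstoD) auto
  \<comment> \<open>comparing the winding with the imaginary part costs a factor 2\<close>
  then have "\<exists>\<^sub>F n in sequentially. real (Suc (2 * C)) * f ((1/2) ^ n) < Im (z ((1/2) ^ Suc n)) \<and> (1/2::real) ^ n < min \<delta> b"
    by (rule frequently_eventually_frequently[OF large])
  then obtain n where n: "real (Suc (2 * C)) * f ((1/2) ^ n) < Im (z ((1/2) ^ Suc n))" "(1/2::real) ^ n < min \<delta> b"
    by (auto dest: frequently_ex)
  define t :: real where "t = (1/2) ^ Suc n"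
  have t: "0 < t" "t < \<delta>" "2 * t = (1/2) ^ n" using n(2) \<delta> by (auto simp: t_def)
  obtain u where u: "0 < u" "u \<le> 2 * t" "A u = t" using A[OF t(1,2)] by blast
  have "real C * f u \<le> real C * f ((1/2) ^ n)"
    using u t by (intro mult_left_mono mono_onD[OF mono]) auto
  moreover have fn: "0 < f ((1/2) ^ n)" by (simp add: pos)
  moreover have im: "(2 * real C + 1) * f ((1/2) ^ n) < Im (z t)" using n(1) by (simp add: t_def algebra_simps)
  moreover have "0 \<le> (2 * real C + 1) * f ((1/2) ^ n)" using fn by simp
  then have "Im (z t) / 2 \<le> \<theta> t" using im t by (intro th) auto
  ultimately have "real C * f u < \<theta> t" by (simp add: algebra_simps)
  moreover have "\<theta> (A u) / f u < C" using u t n(2) by (intro b(2)) auto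
  ultimately show False using u pos[OF u(1)] by (simp add: pos_divide_less_eq)
qed

end

section \<open>The integral test for the time-changed winding process\<close>

text \<open>
Testing the planar characteristic function with the purely imaginary vectors \<open>u \<i>\<close> gives
that of the imaginary part.
\<close>

lemma (in prob_space) stable_process_Im:
  assumes \<alpha>: "0 < \<alpha>" "\<alpha> < 2" and Z: "isotropic_stable_process \<alpha> z\<^sub>0 Z"
  shows "stable_process M \<alpha> (\<lambda>t \<omega>. Im (Z t \<omega> - Z 0 \<omega>))"
proof unfold_locales
  let ?Y = "\<lambda>t \<omega>. Im (Z t \<omega> - Z 0 \<omega>)"
  have rv: "0 \<le> t \<Longrightarrow> random_variable borel (Z t)" for t
    using Z by (auto simp: isotropic_stable_process_def)
  show "0 < \<alpha>" "\<alpha> < 2" by fact+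
  show "?Y 0 \<omega> = 0" for \<omega> by simp
  show "symmetric_stable \<alpha> (t - s) (\<lambda>\<omega>. ?Y t \<omega> - ?Y s \<omega>)" if st: "0 \<le> s" "s \<le> t" for s t
    unfolding symmetric_stable_def
  proof (intro conjI allI)
    have [measurable]: "random_variable borel (Z s)" "random_variable borel (Z t)"
      "random_variable borel (Z 0)" "random_variable borel (Z (t - s))"
      using st by (auto intro: rv)
    show "random_variable borel (\<lambda>\<omega>. ?Y t \<omega> - ?Y s \<omega>)" by measurable
    fix u
    let ?g = "\<lambda>w. exp (\<i> * complex_of_real ((u *\<^sub>R \<i>) \<bullet> w))"
    have g: "?g \<in> borel_measurable borel" by measurable
    have "stationary_increments Z" using Z by (simp add: isotropic_stable_process_def)
    note stationary = this[unfolded stationary_increments_def, rule_format]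
    have "distr M borel (\<lambda>\<omega>. Z (s + (t - s)) \<omega> - Z s \<omega>) = distr M borel (\<lambda>\<omega>. Z (t - s) \<omega> - Z 0 \<omega>)"
      using st by (intro stationary) auto
    then have law: "distr M borel (\<lambda>\<omega>. Z t \<omega> - Z s \<omega>) = distr M borel (\<lambda>\<omega>. Z (t - s) \<omega> - Z 0 \<omega>)" by simp
    have "\<forall>t\<ge>0. \<forall>\<xi>. expectation (\<lambda>\<omega>. exp (\<i> * complex_of_real (\<xi> \<bullet> (Z t \<omega> - Z 0 \<omega>)))) =
        complex_of_real (exp (- (t * norm \<xi> powr \<alpha>)))"
      using Z unfolding isotropic_stable_process_def by blast
    note cf = this[rule_format]
    have "char (distr M borel (\<lambda>\<omega>. ?Y t \<omega> - ?Y s \<omega>)) u = expectation (\<lambda>\<omega>. ?g (Z t \<omega> - Z s \<omega>))"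
      by (simp add: char_def integral_distr inner_complex_def)
    also have "\<dots> = (\<integral>w. ?g w \<partial>distr M borel (\<lambda>\<omega>. Z t \<omega> - Z s \<omega>))"
      by (rule integral_distr[symmetric, OF _ g]) measurable
    also have "\<dots> = expectation (\<lambda>\<omega>. ?g (Z (t - s) \<omega> - Z 0 \<omega>))"
      unfolding law by (rule integral_distr[OF _ g]) measurable
    also have "\<dots> = complex_of_real (exp (- ((t - s) * norm (u *\<^sub>R \<i>) powr \<alpha>)))"
      using st by (intro cf) simp
    finally show "char (distr M borel (\<lambda>\<omega>. ?Y t \<omega> - ?Y s \<omega>)) u = complex_of_real (exp (- ((t - s) * \<bar>u\<bar> powr \<alpha>)))"
      by simp
  qed
  show "indep_vars (\<lambda>_. borel) (\<lambda>i \<omega>. ?Y (\<tau> (Suc i)) \<omega> - ?Y (\<tau> i) \<omega>) {..<n}"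
    if "0 \<le> \<tau> 0" "\<And>i. i < n \<Longrightarrow> \<tau> i \<le> \<tau> (Suc i)" for \<tau> :: "nat \<Rightarrow> real" and n
  proof -
    have "indep_vars (\<lambda>_. borel) (\<lambda>i \<omega>. Z (\<tau> (Suc i)) \<omega> - Z (\<tau> i) \<omega>) {..<n}"
      using Z that by (auto simp: isotropic_stable_process_def independent_increments_def)
    then have "indep_vars (\<lambda>_. borel) (\<lambda>i \<omega>. Im (Z (\<tau> (Suc i)) \<omega> - Z (\<tau> i) \<omega>)) {..<n}"
      by (rule indep_vars_compose2) measurable
    then show ?thesis by simp
  qed
  have "AE \<omega> in M. cadlag (\<lambda>t. Z t \<omega>)" using Z by (auto simp: isotropic_stable_process_def)
  then show "AE \<omega> in M. \<forall>t\<ge>0. ((\<lambda>s. ?Y s \<omega>) \<longlongrightarrow> ?Y t \<omega>) (at_right t)"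
    by eventually_elim (auto simp: cadlag_def intro!: tendsto_intros)
qed

theorem theorem5p1:
  fixes M :: "'a measure" and \<alpha> :: real
    and Z :: "real \<Rightarrow> 'a \<Rightarrow> complex"
    and \<theta> \<rho> :: "real \<Rightarrow> 'a \<Rightarrow> real"
    and f :: "real \<Rightarrow> real"
  assumes "prob_space M"
    and "0 < \<alpha>" and "\<alpha> < 2"
    and "prob_space.isotropic_stable_process M \<alpha> 1 Z"
    and "AE \<omega> in M. is_winding_path (\<lambda>t. Z t \<omega>) (\<lambda>t. \<theta> t \<omega>)"
    and "\<rho> = time_changed_winding \<alpha> Z \<theta>"
    and "\<And>t. 0 < t \<Longrightarrow> 0 < f t"
    and "mono_on {0<..} f"
  shows "((AE \<omega> in M. Limsup (at_right 0) (\<lambda>t. ereal (\<rho> t \<omega> / f t)) = 0) \<longleftrightarrow>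
            (\<integral>\<^sup>+ t \<in> {0<..1}. ennreal (f t powr - \<alpha>) \<partial>lborel) < \<infinity>) \<and>
         ((AE \<omega> in M. Limsup (at_right 0) (\<lambda>t. ereal (\<rho> t \<omega> / f t)) = \<infinity>) \<longleftrightarrow>
            (\<integral>\<^sup>+ t \<in> {0<..1}. ennreal (f t powr - \<alpha>) \<partial>lborel) = \<infinity>)"
proof -
  note pos = assms(7) and mono = assms(8)
  interpret prob_space M by fact
  interpret Y: stable_process M \<alpha> "\<lambda>t \<omega>. Im (Z t \<omega> - Z 0 \<omega>)"
    using assms(2-4) by (rule stable_process_Im)
  let ?I = "\<integral>\<^sup>+ t \<in> {0<..1}. ennreal (f t powr - \<alpha>) \<partial>lborel"
  let ?L = "\<lambda>\<omega>. Limsup (at_right 0) (\<lambda>t. ereal (\<rho> t \<omega> / f t))"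
  have "antimono_on {0<..} (\<lambda>t. f t powr - \<alpha>)"
    using mono pos \<open>0 < \<alpha>\<close> by (auto simp: monotone_on_def intro!: powr_mono2')
  then have series: "?I < \<infinity> \<longleftrightarrow> summable (\<lambda>n. (1/2) ^ n * f ((1/2) ^ n) powr - \<alpha>)"
    by (intro antimono_integral_finite_iff_dyadic_summable) auto
  have start: "AE \<omega> in M. Z 0 \<omega> = 1" and cadlag: "AE \<omega> in M. cadlag (\<lambda>t. Z t \<omega>)"
    using assms(4) by (auto simp: isotropic_stable_process_def)
  from assms(5) start cadlag
  have path: "AE \<omega> in M. winding_start (\<lambda>t. Z t \<omega>) (\<lambda>t. \<theta> t \<omega>) \<and> Im (Z 0 \<omega>) = 0"
    by eventually_elim (simp add: winding_start_def)
  have \<rho>: "\<rho> t \<omega> = \<theta> (inverse_clock \<alpha> (\<lambda>t. Z t \<omega>) t) \<omega>" for t \<omega>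
    by (simp add: assms(6) time_changed_winding_def)
  have finite: "AE \<omega> in M. ?L \<omega> = 0" if "?I < \<infinity>"
  proof -
    have "AE \<omega> in M. \<forall>\<epsilon>\<in>\<rat> \<inter> {0<..}. \<forall>\<^sub>F u in at_right 0. \<forall>s\<in>{0..2*u}. \<bar>Im (Z s \<omega> - Z 0 \<omega>)\<bar> \<le> \<epsilon> * f u"
      using series that by (intro AE_ball_countable' Y.small_near_zero pos mono) (auto intro: countable_rat)
    then show ?thesis using path
    proof eventually_elim
      case (elim \<omega>)
      then interpret winding_start \<alpha> "\<lambda>t. Z t \<omega>" "\<lambda>t. \<theta> t \<omega>" by simp
      show ?case unfolding \<rho> using elim by (intro Limsup_eq_0 pos) auto
    qed
  qed
  have infinite: "AE \<omega> in M. ?L \<omega> = \<infinity>" if "?I = \<infinity>"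
  proof -
    have "\<not> summable (\<lambda>n. (1/2) ^ n * f ((1/2) ^ n) powr - \<alpha>)" using series that by simp
    then have "AE \<omega> in M. \<forall>k::nat. \<exists>\<^sub>F n in sequentially. real (Suc k) * f ((1/2) ^ n) < Im (Z ((1/2) ^ Suc n) \<omega> - Z 0 \<omega>)"
      unfolding AE_all_countable by (intro allI Y.large_near_zero pos mono) auto
    then show ?thesis using path
    proof eventually_elim
      case (elim \<omega>)
      then interpret winding_start \<alpha> "\<lambda>t. Z t \<omega>" "\<lambda>t. \<theta> t \<omega>" by simp
      show ?case unfolding \<rho> using elim by (intro Limsup_eq_infinity pos mono) auto
    qed
  qed
  \<comment> \<open>a probability space does not admit both alternatives almost surely, which yields the converse implications\<close>
  have exclusive: False if "AE \<omega> in M. ?L \<omega> = 0" "AE \<omega> in M. ?L \<omega> = \<infinity>"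
  proof -
    have "AE \<omega> in M. False" using that by eventually_elim simp
    then show False by simp
  qed
  show ?thesis
    using finite infinite exclusive by (cases "?I = \<infinity>") (auto simp: top.not_eq_extremum)
qed

end
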